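(* Let $\mathscr{A}$ be an abelian category with enough injective objects, and let $\mathscr{T}$ be a subcategory of $\mathscr{A}$ containing all injective objects of $\mathscr{A}$. Then the following statements are equivalent. (1) $\mathscr{T}$ is coresolving. (2) For any exact sequence $0 \to A_1 \to A_2 \to A_3 \to 0$ in $\mathscr{A}$, we have (i) $\mathscr{T}\text{-}\operatorname{id} A_2\leq \max\{\mathscr{T}\text{-}\operatorname{id} A_1,\mathscr{T}\text{-}\operatorname{id} A_3\}$, and equality holds if $\mathscr{T}\text{-}\operatorname{id} A_1\neq\mathscr{T}\text{-}\operatorname{id} A_3+1$; (ii) $\mathscr{T}\text{-}\operatorname{id} A_3\leq \max\{\mathscr{T}\text{-}\operatorname{id} A_1-1,\mathscr{T}\text{-}\operatorname{id} A_2\}$, and equality holds if $\mathscr{T}\text{-}\operatorname{id} A_1\neq\mathscr{T}\text{-}\operatorname{id} A_2$; (iii) $\mathscr{T}\text{-}\operatorname{id} A_1\leq \max\{\mathscr{T}\text{-}\operatorname{id} A_2,\mathscr{T}\text{-}\operatorname{id} A_3+1\}$, and equality holds if $\mathscr{T}\text{-}\operatorname{id} A_2\neq\mathscr{T}\text{-}\operatorname{id} A_3$.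
   Context: All subcategories are full, additive and closed under isomorphisms and direct summands. For a subcategory $\mathscr{X}$ of $\mathscr{A}$ and $M\in\mathscr{A}$, the $\mathscr{X}$-injective dimension $\mathscr{X}\text{-}\operatorname{id} M$ is the infimum of the integers $n\ge 0$ such that there is an exact sequence $0 \to M\to X^0\to X^1\to\cdots \to X^n\to 0$ in $\mathscr{A}$ with all $X^i\in\mathscr{X}$, and $\mathscr{X}\text{-}\operatorname{id} M=\infty$ if no such integer exists (with $\infty\pm 1=\infty$). A subcategory $\mathscr{T}$ is coresolving if it contains all injective objects of $\mathscr{A}$ and is closed under extensions and cokernels of monomorphisms. *)

theory Defs
  imports "HOL-Algebra.Group" "HOL-Library.Extended_Nat"
begin

section \<open>Preadditive categories\<close>

text \<open>
  Arrows carry their domain and codomain. Addition \<open>plus\<close> is meaningful only on parallel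
  arrows; \<open>zero C a b\<close> is the zero arrow from \<open>a\<close> to \<open>b\<close>.
\<close>

record ('o, 'm) cat_data =
  obj :: "'o set"
  arr :: "'m set"
  dom :: "'m \<Rightarrow> 'o"
  cod :: "'m \<Rightarrow> 'o"
  ident :: "'o \<Rightarrow> 'm"
  comp :: "'m \<Rightarrow> 'm \<Rightarrow> 'm"  (infixl \<open>\<odot>\<index>\<close> 70)

record ('o, 'm) preadditive_data = "('o, 'm) cat_data" +
  plus :: "'m \<Rightarrow> 'm \<Rightarrow> 'm"  (infixl \<open>\<boxplus>\<index>\<close> 65)
  zero :: "'o \<Rightarrow> 'o \<Rightarrow> 'm"

definition arrows :: "('o, 'm, 'x) cat_data_scheme \<Rightarrow> 'o \<Rightarrow> 'o \<Rightarrow> 'm set" where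
  "arrows C a b = {f \<in> arr C. dom C f = a \<and> cod C f = b}"

locale category =
  fixes C (structure)
  assumes dom_obj: "f \<in> arr C \<Longrightarrow> dom C f \<in> obj C"
    and cod_obj: "f \<in> arr C \<Longrightarrow> cod C f \<in> obj C"
    and ident_arrow: "a \<in> obj C \<Longrightarrow> ident C a \<in> arrows C a a"
    and comp_arrow: "\<lbrakk>f \<in> arrows C a b; g \<in> arrows C b c\<rbrakk> \<Longrightarrow> g \<odot> f \<in> arrows C a c"
    and comp_ident_right: "f \<in> arrows C a b \<Longrightarrow> f \<odot> ident C a = f"
    and comp_ident_left: "f \<in> arrows C a b \<Longrightarrow> ident C b \<odot> f = f"
    and comp_assoc: "\<lbrakk>f \<in> arrows C a b; g \<in> arrows C b c; h \<in> arrows C c d\<rbrakk>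
      \<Longrightarrow> (h \<odot> g) \<odot> f = h \<odot> (g \<odot> f)"

locale preadditive_category = category +
  assumes arrows_comm_group: "\<lbrakk>a \<in> obj C; b \<in> obj C\<rbrakk>
      \<Longrightarrow> comm_group \<lparr>carrier = arrows C a b, mult = (\<boxplus>), one = zero C a b\<rparr>"
    and comp_plus_right: "\<lbrakk>f \<in> arrows C a b; f' \<in> arrows C a b; g \<in> arrows C b c\<rbrakk>
      \<Longrightarrow> g \<odot> (f \<boxplus> f') = (g \<odot> f) \<boxplus> (g \<odot> f')"
    and comp_plus_left: "\<lbrakk>f \<in> arrows C a b; g \<in> arrows C b c; g' \<in> arrows C b c\<rbrakk>
      \<Longrightarrow> (g \<boxplus> g') \<odot> f = (g \<odot> f) \<boxplus> (g' \<odot> f)"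


section \<open>Abelian categories\<close>

definition zero_object :: "('o, 'm, 'x) cat_data_scheme \<Rightarrow> 'o \<Rightarrow> bool" where
  "zero_object C z \<longleftrightarrow> z \<in> obj C \<and>
     (\<forall>a\<in>obj C. (\<exists>!f. f \<in> arrows C a z) \<and> (\<exists>!f. f \<in> arrows C z a))"

definition iso_objects :: "('o, 'm, 'x) cat_data_scheme \<Rightarrow> 'o \<Rightarrow> 'o \<Rightarrow> bool" where
  "iso_objects C a b \<longleftrightarrow> a \<in> obj C \<and> b \<in> obj C \<and>
     (\<exists>f\<in>arrows C a b. \<exists>g\<in>arrows C b a.
        comp C g f = ident C a \<and> comp C f g = ident C b)"

definition is_mono :: "('o, 'm, 'x) cat_data_scheme \<Rightarrow> 'm \<Rightarrow> bool" where
  "is_mono C m \<longleftrightarrow> m \<in> arr C \<and>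
     (\<forall>x. \<forall>u\<in>arrows C x (dom C m). \<forall>v\<in>arrows C x (dom C m).
        comp C m u = comp C m v \<longrightarrow> u = v)"

definition is_epi :: "('o, 'm, 'x) cat_data_scheme \<Rightarrow> 'm \<Rightarrow> bool" where
  "is_epi C e \<longleftrightarrow> e \<in> arr C \<and>
     (\<forall>x. \<forall>u\<in>arrows C (cod C e) x. \<forall>v\<in>arrows C (cod C e) x.
        comp C u e = comp C v e \<longrightarrow> u = v)"

definition is_direct_sum :: "('o, 'm, 'x) preadditive_data_scheme \<Rightarrow> 'o \<Rightarrow> 'o \<Rightarrow> 'o \<Rightarrow> bool" where
  "is_direct_sum C s a b \<longleftrightarrow> s \<in> obj C \<and> a \<in> obj C \<and> b \<in> obj C \<and>
     (\<exists>i\<in>arrows C a s. \<exists>j\<in>arrows C b s. \<exists>p\<in>arrows C s a. \<exists>q\<in>arrows C s b.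
        comp C p i = ident C a \<and> comp C q j = ident C b \<and>
        comp C p j = zero C b a \<and> comp C q i = zero C a b \<and>
        plus C (comp C i p) (comp C j q) = ident C s)"

definition is_kernel :: "('o, 'm, 'x) preadditive_data_scheme \<Rightarrow> 'm \<Rightarrow> 'm \<Rightarrow> bool" where
  "is_kernel C k f \<longleftrightarrow> k \<in> arr C \<and> f \<in> arr C \<and> cod C k = dom C f \<and>
     comp C f k = zero C (dom C k) (cod C f) \<and>
     (\<forall>x. \<forall>u\<in>arrows C x (dom C f). comp C f u = zero C x (cod C f) \<longrightarrow>
        (\<exists>!v. v \<in> arrows C x (dom C k) \<and> comp C k v = u))"

definition is_cokernel :: "('o, 'm, 'x) preadditive_data_scheme \<Rightarrow> 'm \<Rightarrow> 'm \<Rightarrow> bool" where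
  "is_cokernel C c f \<longleftrightarrow> c \<in> arr C \<and> f \<in> arr C \<and> dom C c = cod C f \<and>
     comp C c f = zero C (dom C f) (cod C c) \<and>
     (\<forall>x. \<forall>u\<in>arrows C (cod C f) x. comp C u f = zero C (dom C f) x \<longrightarrow>
        (\<exists>!v. v \<in> arrows C (cod C c) x \<and> comp C v c = u))"

locale abelian_category = preadditive_category +
  assumes zero_object_exists: "\<exists>z. zero_object C z"
    and direct_sum_exists: "\<lbrakk>a \<in> obj C; b \<in> obj C\<rbrakk> \<Longrightarrow> \<exists>s. is_direct_sum C s a b"
    and kernel_exists: "f \<in> arr C \<Longrightarrow> \<exists>k. is_kernel C k f"
    and cokernel_exists: "f \<in> arr C \<Longrightarrow> \<exists>c. is_cokernel C c f"
    and mono_is_kernel: "is_mono C m \<Longrightarrow> \<exists>f. is_kernel C m f"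
    and epi_is_cokernel: "is_epi C e \<Longrightarrow> \<exists>f. is_cokernel C e f"


section \<open>Exact sequences\<close>

text \<open>The image of an arrow is the kernel of its cokernel.\<close>

definition is_image :: "('o, 'm, 'x) preadditive_data_scheme \<Rightarrow> 'm \<Rightarrow> 'm \<Rightarrow> bool" where
  "is_image C m f \<longleftrightarrow> (\<exists>c. is_cokernel C c f \<and> is_kernel C m c)"

text \<open>
  Images and kernels are subobjects, determined up to isomorphism only, so \<open>Im f = Ker g\<close>
  says that a single monomorphism represents both.
\<close>

definition exact_at :: "('o, 'm, 'x) preadditive_data_scheme \<Rightarrow> 'm \<Rightarrow> 'm \<Rightarrow> bool" where
  "exact_at C f g \<longleftrightarrow> f \<in> arr C \<and> g \<in> arr C \<and> cod C f = dom C g \<and>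
     (\<exists>m. is_image C m f \<and> is_kernel C m g)"

definition exact_sequence :: "('o, 'm, 'x) preadditive_data_scheme \<Rightarrow> 'm list \<Rightarrow> bool" where
  "exact_sequence C fs \<longleftrightarrow>
     (\<forall>i. Suc i < length fs \<longrightarrow> exact_at C (fs ! i) (fs ! Suc i))"

definition short_exact ::
    "('o, 'm, 'x) preadditive_data_scheme \<Rightarrow> 'o \<Rightarrow> 'm \<Rightarrow> 'o \<Rightarrow> 'm \<Rightarrow> 'o \<Rightarrow> bool" where
  "short_exact C a f b g c \<longleftrightarrow> f \<in> arrows C a b \<and> g \<in> arrows C b c \<and>
     (\<exists>z. zero_object C z \<and> exact_sequence C [zero C z a, f, g, zero C c z])"


section \<open>Injective objects\<close>

definition injective_object :: "('o, 'm, 'x) cat_data_scheme \<Rightarrow> 'o \<Rightarrow> bool" where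
  "injective_object C e \<longleftrightarrow> e \<in> obj C \<and>
     (\<forall>m. is_mono C m \<longrightarrow> (\<forall>f\<in>arrows C (dom C m) e.
        \<exists>g\<in>arrows C (cod C m) e. comp C g m = f))"

definition enough_injectives :: "('o, 'm, 'x) cat_data_scheme \<Rightarrow> bool" where
  "enough_injectives C \<longleftrightarrow>
     (\<forall>a\<in>obj C. \<exists>e. injective_object C e \<and> (\<exists>m\<in>arrows C a e. is_mono C m))"


section \<open>Subcategories and relative injective dimension\<close>

text \<open>
  A full subcategory is given by its set of objects. As a standing convention, subcategories
  are additive and closed under isomorphisms and direct summands.
\<close>

definition subcategory :: "('o, 'm, 'x) preadditive_data_scheme \<Rightarrow> 'o set \<Rightarrow> bool" where
  "subcategory C X \<longleftrightarrow> X \<subseteq> obj C \<and>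
     (\<exists>z\<in>X. zero_object C z) \<and>
     (\<forall>a\<in>X. \<forall>b\<in>X. \<forall>s. is_direct_sum C s a b \<longrightarrow> s \<in> X) \<and>
     (\<forall>a\<in>X. \<forall>b. iso_objects C a b \<longrightarrow> b \<in> X) \<and>
     (\<forall>s\<in>X. \<forall>a b. is_direct_sum C s a b \<longrightarrow> a \<in> X \<and> b \<in> X)"

text \<open>
  \<open>has_coresolution C X M n\<close>: there is an exact sequence
  \<open>0 \<rightarrow> M \<rightarrow> X\<^sup>0 \<rightarrow> \<dots> \<rightarrow> X\<^sup>n \<rightarrow> 0\<close> with all \<open>X\<^sup>i\<close> in \<open>X\<close>. The list \<open>ds\<close> consists of the
  \<open>n + 1\<close> arrows between the two zero objects, so that the \<open>X\<^sup>i\<close> are their codomains.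
\<close>

definition has_coresolution ::
    "('o, 'm, 'x) preadditive_data_scheme \<Rightarrow> 'o set \<Rightarrow> 'o \<Rightarrow> nat \<Rightarrow> bool" where
  "has_coresolution C X M n \<longleftrightarrow>
     (\<exists>z ds. zero_object C z \<and> length ds = Suc n \<and>
        dom C (hd ds) = M \<and> (\<forall>d\<in>set ds. cod C d \<in> X) \<and>
        exact_sequence C (zero C z M # ds @ [zero C (cod C (last ds)) z]))"

text \<open>The infimum of the empty set in \<open>enat\<close> is \<open>\<infinity>\<close>.\<close>

definition inj_dim :: "('o, 'm, 'x) preadditive_data_scheme \<Rightarrow> 'o set \<Rightarrow> 'o \<Rightarrow> enat" where
  "inj_dim C X M = Inf (enat ` {n. has_coresolution C X M n})"

definition coresolving :: "('o, 'm, 'x) preadditive_data_scheme \<Rightarrow> 'o set \<Rightarrow> bool" where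
  "coresolving C X \<longleftrightarrow>
     (\<forall>e. injective_object C e \<longrightarrow> e \<in> X) \<and>
     (\<forall>a f b g c. short_exact C a f b g c \<and> a \<in> X \<and> c \<in> X \<longrightarrow> b \<in> X) \<and>
     (\<forall>m c. is_mono C m \<and> dom C m \<in> X \<and> cod C m \<in> X \<and> is_cokernel C c m
        \<longrightarrow> cod C c \<in> X)"

text \<open>
  Arithmetic of dimensions takes place in \<open>enat\<close>, where \<open>\<infinity> - 1 = \<infinity>\<close> and \<open>0 - 1 = 0\<close>. A term
  \<open>inj_dim C X a - 1\<close> that occurs only as an argument of \<open>max\<close> next to another dimension is
  unaffected by the truncation, as dimensions are nonnegative.
\<close>

end

theory Submission
  imports Defs
begin

text \<open>
  Over a coresolving \<open>T\<close>, the bounds \<open>T-id M \<le> n\<close> obey three rules along a short exact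
  sequence \<open>A1 \<rightarrow> A2 \<rightarrow> A3\<close>. The bound passes to extensions by induction on \<open>n\<close>: as injectives
  and the cokernels of their \<open>T\<close>-subobjects lie in \<open>T\<close>, the first term of a
  coresolution of \<open>A1\<close> may be taken injective, and then the horseshoe lemma applies. The bounds
  for \<open>A1\<close> and \<open>A3\<close> follow by composing with the first step of a coresolution and taking
  cokernels. The equality clauses are arithmetic consequences of the three inequalities.
  Conversely, \<open>T\<close> consists of the objects of dimension \<open>0\<close>, so the inequalities contain
  the closure properties.
\<close>

section \<open>Preadditive and abelian categories\<close>

text \<open>The horseshoe construction has to extend an arrow on \<open>A1\<close> to the whole of
  \<open>A2\<close>, which a target that merely lies in \<open>T\<close> need not allow; hence the
  detour through injectives. It threatens to be circular: once the first term is replaced by an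
  injective one, the new cokernel is an extension of an object of \<open>T\<close> by the old
  cokernel, so bounding it by \<open>n\<close> takes the extension rule at level \<open>n\<close>.
  This is the induction hypothesis available at level \<open>Suc n\<close>, so the replacement takes
  place inside that induction. The rules for \<open>A1\<close> and \<open>A3\<close> come afterwards
  and may use the extension rule at every level.

  The two large diagram lemmas use neither elements nor the snake lemma. A short exact sequence is
  treated as a mono together with its cokernel, so exactness in the middle is a universal property.
  What this does not give directly is that an induced arrow out of a cokernel is mono; there the
  injectives serve once more, as test objects.\<close>

lemma arrowsI: "f \<in> arr C \<Longrightarrow> f \<in> arrows C (dom C f) (cod C f)"
  by (simp add: arrows_def)

lemma arrowsD: "f \<in> arrows C a b \<Longrightarrow> f \<in> arr C \<and> dom C f = a \<and> cod C f = b"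
  by (simp add: arrows_def)

lemma monoI:
  assumes "m \<in> arrows C a b"
    and "\<And>x u v. \<lbrakk>u \<in> arrows C x a; v \<in> arrows C x a; comp C m u = comp C m v\<rbrakk> \<Longrightarrow> u = v"
  shows "is_mono C m"
proof -
  have "m \<in> arr C" "dom C m = a" using arrowsD[OF assms(1)] by auto
  then show ?thesis unfolding is_mono_def using assms(2) by blast
qed

lemma epiI:
  assumes "e \<in> arrows C a b"
    and "\<And>x u v. \<lbrakk>u \<in> arrows C b x; v \<in> arrows C b x; comp C u e = comp C v e\<rbrakk> \<Longrightarrow> u = v"
  shows "is_epi C e"
proof -
  have "e \<in> arr C" "cod C e = b" using arrowsD[OF assms(1)] by auto
  then show ?thesis unfolding is_epi_def using assms(2) by blast
qed

lemma monoD: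
  assumes "is_mono C m" "m \<in> arrows C a b" "u \<in> arrows C x a" "v \<in> arrows C x a"
    and "comp C m u = comp C m v"
  shows "u = v"
proof -
  have "dom C m = a" using arrowsD[OF assms(2)] by simp
  then show ?thesis using assms unfolding is_mono_def by blast
qed

lemma epiD:
  assumes "is_epi C e" "e \<in> arrows C a b" "u \<in> arrows C b x" "v \<in> arrows C b x"
    and "comp C u e = comp C v e"
  shows "u = v"
proof -
  have "cod C e = b" using arrowsD[OF assms(2)] by simp
  then show ?thesis using assms unfolding is_epi_def by blast
qed

section \<open>Kernels and cokernels through their universal properties\<close>

lemma kernel_arrows: "\<lbrakk>is_kernel C k f; f \<in> arrows C a b\<rbrakk> \<Longrightarrow> k \<in> arrows C (dom C k) a"
  by (simp add: is_kernel_def arrows_def)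

lemma cokernel_arrows: "\<lbrakk>is_cokernel C c f; f \<in> arrows C a b\<rbrakk> \<Longrightarrow> c \<in> arrows C b (cod C c)"
  by (simp add: is_cokernel_def arrows_def)

lemma kernel_zero:
  assumes "is_kernel C k f" "k \<in> arrows C x a" "f \<in> arrows C a b"
  shows "comp C f k = zero C x b"
proof -
  have "dom C k = x" "cod C f = b" using assms by (simp_all add: arrows_def)
  then show ?thesis using assms(1) unfolding is_kernel_def by blast
qed

lemma cokernel_zero:
  assumes "is_cokernel C c f" "f \<in> arrows C a b" "c \<in> arrows C b d"
  shows "comp C c f = zero C a d"
proof -
  have "dom C f = a" "cod C c = d" using assms by (simp_all add: arrows_def)
  then show ?thesis using assms(1) unfolding is_cokernel_def by blast
qed

lemma kernel_factor_unique:
  assumes "is_kernel C k f" "k \<in> arrows C x a" "f \<in> arrows C a b"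
    and "u \<in> arrows C y a" "comp C f u = zero C y b"
  shows "\<exists>!v. v \<in> arrows C y x \<and> comp C k v = u"
proof -
  have "dom C k = x" "dom C f = a" "cod C f = b" using assms(2,3) by (simp_all add: arrows_def)
  then show ?thesis using assms(1,4,5) unfolding is_kernel_def by blast
qed

lemma cokernel_factor_unique:
  assumes "is_cokernel C c f" "f \<in> arrows C a b" "c \<in> arrows C b d"
    and "u \<in> arrows C b y" "comp C u f = zero C a y"
  shows "\<exists>!v. v \<in> arrows C d y \<and> comp C v c = u"
proof -
  have "dom C f = a" "cod C f = b" "cod C c = d" using assms(2,3) by (simp_all add: arrows_def)
  then show ?thesis using assms(1,4,5) unfolding is_cokernel_def by blast
qed

lemma kernel_factor:
  assumes "is_kernel C k f" "k \<in> arrows C x a" "f \<in> arrows C a b"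
    and "u \<in> arrows C y a" "comp C f u = zero C y b"
  obtains v where "v \<in> arrows C y x" "comp C k v = u"
  using kernel_factor_unique[OF assms] that by blast

lemma cokernel_factor:
  assumes "is_cokernel C c f" "f \<in> arrows C a b" "c \<in> arrows C b d"
    and "u \<in> arrows C b y" "comp C u f = zero C a y"
  obtains v where "v \<in> arrows C d y" "comp C v c = u"
  using cokernel_factor_unique[OF assms] that by blast

section \<open>Composition and cancellation of monos and epis\<close>

context category
begin

lemma arrows_obj: "f \<in> arrows C a b \<Longrightarrow> a \<in> obj C \<and> b \<in> obj C"
  using dom_obj cod_obj by (auto simp: arrows_def)

lemma mono_comp:
  assumes "is_mono C f" "is_mono C g" "f \<in> arrows C a b" "g \<in> arrows C b c"
  shows "is_mono C (g \<odot> f)"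
proof -
  have gf: "g \<odot> f \<in> arrows C a c" using assms(3,4) by (rule comp_arrow)
  have "u = v" if "u \<in> arrows C x a" "v \<in> arrows C x a" "(g \<odot> f) \<odot> u = (g \<odot> f) \<odot> v" for x u v
  proof -
    have "g \<odot> (f \<odot> u) = g \<odot> (f \<odot> v)"
      using that(3) comp_assoc[OF that(1) assms(3,4)] comp_assoc[OF that(2) assms(3,4)] by simp
    then have "f \<odot> u = f \<odot> v"
      by (rule monoD[OF assms(2,4) comp_arrow[OF that(1) assms(3)] comp_arrow[OF that(2) assms(3)]])
    then show ?thesis by (rule monoD[OF assms(1,3) that(1,2)])
  qed
  then show ?thesis by (rule monoI[OF gf])
qed

lemma mono_cancel:
  assumes "is_mono C (g \<odot> f)" "f \<in> arrows C a b" "g \<in> arrows C b c"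
  shows "is_mono C f"
proof -
  have gf: "g \<odot> f \<in> arrows C a c" using assms(2,3) by (rule comp_arrow)
  have "u = v" if "u \<in> arrows C x a" "v \<in> arrows C x a" "f \<odot> u = f \<odot> v" for x u v
    using monoD[OF assms(1) gf that(1,2)] that(3)
      comp_assoc[OF that(1) assms(2,3)] comp_assoc[OF that(2) assms(2,3)] by simp
  then show ?thesis by (rule monoI[OF assms(2)])
qed

lemma epi_comp:
  assumes "is_epi C f" "is_epi C g" "f \<in> arrows C a b" "g \<in> arrows C b c"
  shows "is_epi C (g \<odot> f)"
proof -
  have gf: "g \<odot> f \<in> arrows C a c" using assms(3,4) by (rule comp_arrow)
  have "u = v" if "u \<in> arrows C c x" "v \<in> arrows C c x" "u \<odot> (g \<odot> f) = v \<odot> (g \<odot> f)" for x u v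
  proof -
    have "(u \<odot> g) \<odot> f = (v \<odot> g) \<odot> f"
      using that(3) comp_assoc[OF assms(3,4) that(1)] comp_assoc[OF assms(3,4) that(2)] by simp
    then have "u \<odot> g = v \<odot> g"
      by (rule epiD[OF assms(1,3) comp_arrow[OF assms(4) that(1)] comp_arrow[OF assms(4) that(2)]])
    then show ?thesis by (rule epiD[OF assms(2,4) that(1,2)])
  qed
  then show ?thesis by (rule epiI[OF gf])
qed

lemma epi_cancel:
  assumes "is_epi C (g \<odot> f)" "f \<in> arrows C a b" "g \<in> arrows C b c"
  shows "is_epi C g"
proof -
  have gf: "g \<odot> f \<in> arrows C a c" using assms(2,3) by (rule comp_arrow)
  have "u = v" if "u \<in> arrows C c x" "v \<in> arrows C c x" "u \<odot> g = v \<odot> g" for x u v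
    using epiD[OF assms(1) gf that(1,2)] that(3)
      comp_assoc[OF assms(2,3) that(1)] comp_assoc[OF assms(2,3) that(2)] by simp
  then show ?thesis by (rule epiI[OF assms(3)])
qed

lemma mono_ident: "a \<in> obj C \<Longrightarrow> is_mono C (ident C a)"
  by (rule monoI[OF ident_arrow]) (simp_all add: comp_ident_left)

lemma epi_ident: "a \<in> obj C \<Longrightarrow> is_epi C (ident C a)"
  by (rule epiI[OF ident_arrow]) (simp_all add: comp_ident_right)

end

section \<open>Hom groups and zero arrows\<close>

context preadditive_category
begin

lemma zero_arrow: "\<lbrakk>a \<in> obj C; b \<in> obj C\<rbrakk> \<Longrightarrow> zero C a b \<in> arrows C a b"
  using monoid.one_closed[OF group.is_monoid[OF comm_group.axioms(2)[OF arrows_comm_group]]]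
  by simp

lemma plus_arrow:
  assumes "f \<in> arrows C a b" "g \<in> arrows C a b"
  shows "f \<boxplus> g \<in> arrows C a b"
proof -
  interpret G: comm_group "\<lparr>carrier = arrows C a b, mult = (\<boxplus>), one = zero C a b\<rparr>"
    using arrows_comm_group arrows_obj[OF assms(1)] by blast
  show ?thesis using G.m_closed assms by simp
qed

lemma plus_zero:
  assumes "f \<in> arrows C a b"
  shows "f \<boxplus> zero C a b = f" "zero C a b \<boxplus> f = f"
proof -
  interpret G: comm_group "\<lparr>carrier = arrows C a b, mult = (\<boxplus>), one = zero C a b\<rparr>"
    using arrows_comm_group arrows_obj[OF assms(1)] by blast
  show "f \<boxplus> zero C a b = f" "zero C a b \<boxplus> f = f" using G.r_one G.l_one assms by simp_all
qed

lemma plus_cancel: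
  assumes "f \<in> arrows C a b" "g \<in> arrows C a b" "h \<in> arrows C a b"
  shows "f \<boxplus> h = g \<boxplus> h \<longleftrightarrow> f = g"
proof -
  interpret G: comm_group "\<lparr>carrier = arrows C a b, mult = (\<boxplus>), one = zero C a b\<rparr>"
    using arrows_comm_group arrows_obj[OF assms(1)] by blast
  show ?thesis using G.right_cancel[of h f g] assms by simp
qed

lemma neg_exists:
  assumes "f \<in> arrows C a b"
  obtains g where "g \<in> arrows C a b" "f \<boxplus> g = zero C a b"
proof -
  interpret G: comm_group "\<lparr>carrier = arrows C a b, mult = (\<boxplus>), one = zero C a b\<rparr>"
    using arrows_comm_group arrows_obj[OF assms(1)] by blast
  show thesis using G.r_inv_ex[of f] assms that by auto
qed

lemma comp_zero:
  assumes "g \<in> arrows C b c" "a \<in> obj C"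
  shows "g \<odot> zero C a b = zero C a c"
proof -
  have z: "zero C a b \<in> arrows C a b" and z': "zero C a c \<in> arrows C a c"
    using zero_arrow assms arrows_obj by blast+
  have gz: "g \<odot> zero C a b \<in> arrows C a c" using z assms(1) by (rule comp_arrow)
  have "(g \<odot> zero C a b) \<boxplus> (g \<odot> zero C a b) = g \<odot> zero C a b"
    using comp_plus_right[OF z z assms(1)] plus_zero[OF z] by simp
  also have "\<dots> = zero C a c \<boxplus> (g \<odot> zero C a b)" using plus_zero[OF gz] by simp
  finally show ?thesis using plus_cancel[OF gz z' gz] by simp
qed

lemma zero_comp:
  assumes "f \<in> arrows C a b" "c \<in> obj C"
  shows "zero C b c \<odot> f = zero C a c"
proof -
  have z: "zero C b c \<in> arrows C b c" and z': "zero C a c \<in> arrows C a c"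
    using zero_arrow assms arrows_obj by blast+
  have zf: "zero C b c \<odot> f \<in> arrows C a c" using assms(1) z by (rule comp_arrow)
  have "(zero C b c \<odot> f) \<boxplus> (zero C b c \<odot> f) = zero C b c \<odot> f"
    using comp_plus_left[OF assms(1) z z] plus_zero[OF z] by simp
  also have "\<dots> = zero C a c \<boxplus> (zero C b c \<odot> f)" using plus_zero[OF zf] by simp
  finally show ?thesis using plus_cancel[OF zf z' zf] by simp
qed

lemma monoI_zero:
  assumes m: "m \<in> arrows C a b"
    and "\<And>x u. \<lbrakk>u \<in> arrows C x a; m \<odot> u = zero C x b\<rbrakk> \<Longrightarrow> u = zero C x a"
  shows "is_mono C m"
proof -
  have "u = v" if u: "u \<in> arrows C x a" and v: "v \<in> arrows C x a" and eq: "m \<odot> u = m \<odot> v" for x u v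
  proof -
    obtain w where w: "w \<in> arrows C x a" "v \<boxplus> w = zero C x a" using neg_exists[OF v] .
    have "m \<odot> (u \<boxplus> w) = m \<odot> (v \<boxplus> w)"
      using comp_plus_right[OF u w(1) m] comp_plus_right[OF v w(1) m] eq by simp
    also have "\<dots> = zero C x b" using w(2) comp_zero[OF m] arrows_obj[OF u] by simp
    finally have "u \<boxplus> w = v \<boxplus> w" using assms(2) plus_arrow[OF u w(1)] w(2) by simp
    then show ?thesis using plus_cancel[OF u v w(1)] by simp
  qed
  then show ?thesis by (rule monoI[OF m])
qed

lemma epiI_zero:
  assumes m: "m \<in> arrows C a b"
    and "\<And>x u. \<lbrakk>u \<in> arrows C b x; u \<odot> m = zero C a x\<rbrakk> \<Longrightarrow> u = zero C b x"
  shows "is_epi C m"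
proof -
  have "u = v" if u: "u \<in> arrows C b x" and v: "v \<in> arrows C b x" and eq: "u \<odot> m = v \<odot> m" for x u v
  proof -
    obtain w where w: "w \<in> arrows C b x" "v \<boxplus> w = zero C b x" using neg_exists[OF v] .
    have "(u \<boxplus> w) \<odot> m = (v \<boxplus> w) \<odot> m"
      using comp_plus_left[OF m u w(1)] comp_plus_left[OF m v w(1)] eq by simp
    also have "\<dots> = zero C a x" using w(2) zero_comp[OF m] arrows_obj[OF u] by simp
    finally have "u \<boxplus> w = v \<boxplus> w" using assms(2) plus_arrow[OF u w(1)] w(2) by simp
    then show ?thesis using plus_cancel[OF u v w(1)] by simp
  qed
  then show ?thesis by (rule epiI[OF m])
qed

lemma mono_zero:
  assumes "is_mono C m" "m \<in> arrows C a b" "u \<in> arrows C x a" "m \<odot> u = zero C x b"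
  shows "u = zero C x a"
  by (rule monoD[OF assms(1-3) zero_arrow])
    (use assms(2-4) arrows_obj comp_zero[OF assms(2)] in auto)

lemma epi_zero:
  assumes "is_epi C e" "e \<in> arrows C a b" "u \<in> arrows C b x" "u \<odot> e = zero C a x"
  shows "u = zero C b x"
  by (rule epiD[OF assms(1-3) zero_arrow])
    (use assms(2-4) arrows_obj zero_comp[OF assms(2)] in auto)

section \<open>Kernels and cokernels in preadditive categories\<close>

lemma kernel_mono:
  assumes "is_kernel C k f"
  shows "is_mono C k"
proof -
  define x a b where "x = dom C k" and "a = dom C f" and "b = cod C f"
  have k: "k \<in> arrows C x a" and f: "f \<in> arrows C a b"
    using assms by (simp_all add: is_kernel_def arrows_def x_def a_def b_def)
  have "u = v" if u: "u \<in> arrows C y x" and v: "v \<in> arrows C y x" and eq: "k \<odot> u = k \<odot> v" for y u v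
  proof -
    have "f \<odot> (k \<odot> u) = zero C y b"
      using comp_assoc[OF u k f] kernel_zero[OF assms k f] zero_comp[OF u] arrows_obj[OF f] by simp
    then have "\<exists>!w. w \<in> arrows C y x \<and> k \<odot> w = k \<odot> u"
      using kernel_factor_unique[OF assms k f comp_arrow[OF u k]] by simp
    then show ?thesis using u v eq by auto
  qed
  then show ?thesis by (rule monoI[OF k])
qed

lemma cokernel_epi:
  assumes "is_cokernel C c f"
  shows "is_epi C c"
proof -
  define x a b where "x = cod C c" and "a = cod C f" and "b = dom C f"
  have c: "c \<in> arrows C a x" and f: "f \<in> arrows C b a"
    using assms by (simp_all add: is_cokernel_def arrows_def x_def a_def b_def)
  have "u = v" if u: "u \<in> arrows C x y" and v: "v \<in> arrows C x y" and eq: "u \<odot> c = v \<odot> c" for y u v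
  proof -
    have "(u \<odot> c) \<odot> f = zero C b y"
      using comp_assoc[OF f c u] cokernel_zero[OF assms f c] comp_zero[OF u] arrows_obj[OF f] by simp
    then have "\<exists>!w. w \<in> arrows C x y \<and> w \<odot> c = u \<odot> c"
      using cokernel_factor_unique[OF assms f c comp_arrow[OF c u]] by simp
    then show ?thesis using u v eq by auto
  qed
  then show ?thesis by (rule epiI[OF c])
qed

lemma kernelI:
  assumes k: "k \<in> arrows C x a" and f: "f \<in> arrows C a b" and "is_mono C k"
    and "f \<odot> k = zero C x b"
    and "\<And>y u. \<lbrakk>u \<in> arrows C y a; f \<odot> u = zero C y b\<rbrakk> \<Longrightarrow> \<exists>v\<in>arrows C y x. k \<odot> v = u"
  shows "is_kernel C k f"
proof -
  have "\<exists>!v. v \<in> arrows C y x \<and> k \<odot> v = u" if "u \<in> arrows C y a" "f \<odot> u = zero C y b" for y u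
    using assms(5)[OF that] monoD[OF assms(3) k] by blast
  then show ?thesis using k f assms(4) by (simp add: is_kernel_def arrows_def)
qed

lemma cokernelI:
  assumes c: "c \<in> arrows C b x" and f: "f \<in> arrows C a b" and "is_epi C c"
    and "c \<odot> f = zero C a x"
    and "\<And>y u. \<lbrakk>u \<in> arrows C b y; u \<odot> f = zero C a y\<rbrakk> \<Longrightarrow> \<exists>v\<in>arrows C x y. v \<odot> c = u"
  shows "is_cokernel C c f"
proof -
  have "\<exists>!v. v \<in> arrows C x y \<and> v \<odot> c = u" if "u \<in> arrows C b y" "u \<odot> f = zero C a y" for y u
    using assms(5)[OF that] epiD[OF assms(3) c] by blast
  then show ?thesis using c f assms(4) by (simp add: is_cokernel_def arrows_def)
qed

text \<open>As \<open>e\<close> cancels on the right, the same arrows \<open>u\<close> kill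
  \<open>f \<odot> e\<close> and \<open>f\<close>, and a cokernel depends only on which arrows are
  killed.\<close>

lemma cokernel_precomp_epi:
  assumes e: "e \<in> arrows C a b" "is_epi C e" and f: "f \<in> arrows C b d"
  shows "is_cokernel C c (f \<odot> e) \<longleftrightarrow> is_cokernel C c f"
proof -
  have fe: "f \<odot> e \<in> arrows C a d" using e(1) f by (rule comp_arrow)
  have iff: "u \<odot> (f \<odot> e) = zero C a x \<longleftrightarrow> u \<odot> f = zero C b x" if u: "u \<in> arrows C d x" for u x
  proof
    assume "u \<odot> (f \<odot> e) = zero C a x"
    then have "(u \<odot> f) \<odot> e = zero C a x" using comp_assoc[OF e(1) f u] by simp
    then show "u \<odot> f = zero C b x" by (rule epi_zero[OF e(2,1) comp_arrow[OF f u]])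
  next
    assume "u \<odot> f = zero C b x"
    then show "u \<odot> (f \<odot> e) = zero C a x"
      using comp_assoc[OF e(1) f u] zero_comp[OF e(1)] arrows_obj[OF u] by simp
  qed
  show ?thesis
  proof
    assume c: "is_cokernel C c (f \<odot> e)"
    have ca: "c \<in> arrows C d (cod C c)" using cokernel_arrows[OF c fe] .
    show "is_cokernel C c f"
    proof (rule cokernelI[OF ca f cokernel_epi[OF c]])
      show "c \<odot> f = zero C b (cod C c)" using iff[OF ca] cokernel_zero[OF c fe ca] by simp
      show "\<exists>v\<in>arrows C (cod C c) y. v \<odot> c = u"
        if "u \<in> arrows C d y" "u \<odot> f = zero C b y" for y u
        using cokernel_factor_unique[OF c fe ca that(1) iffD2[OF iff[OF that(1)] that(2)]] by blast
    qed
  next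
    assume c: "is_cokernel C c f"
    have ca: "c \<in> arrows C d (cod C c)" using cokernel_arrows[OF c f] .
    show "is_cokernel C c (f \<odot> e)"
    proof (rule cokernelI[OF ca fe cokernel_epi[OF c]])
      show "c \<odot> (f \<odot> e) = zero C a (cod C c)" using iff[OF ca] cokernel_zero[OF c f ca] by simp
      show "\<exists>v\<in>arrows C (cod C c) y. v \<odot> c = u"
        if "u \<in> arrows C d y" "u \<odot> (f \<odot> e) = zero C a y" for y u
        using cokernel_factor_unique[OF c f ca that(1) iffD1[OF iff[OF that(1)] that(2)]] by blast
    qed
  qed
qed

text \<open>As \<open>m\<close> cancels on the left, \<open>m \<odot> f\<close> and \<open>f\<close>
  kill the same arrows. This is what keeps a spliced sequence exact at the place before the
  splice.\<close>

lemma kernel_postcomp_mono: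
  assumes m: "m \<in> arrows C b d" "is_mono C m" and f: "f \<in> arrows C a b"
    and k: "is_kernel C k f"
  shows "is_kernel C k (m \<odot> f)"
proof -
  have mf: "m \<odot> f \<in> arrows C a d" using f m(1) by (rule comp_arrow)
  have ka: "k \<in> arrows C (dom C k) a" using kernel_arrows[OF k f] .
  have iff: "(m \<odot> f) \<odot> u = zero C x d \<longleftrightarrow> f \<odot> u = zero C x b" if u: "u \<in> arrows C x a" for u x
  proof
    assume "(m \<odot> f) \<odot> u = zero C x d"
    then have "m \<odot> (f \<odot> u) = zero C x d" using comp_assoc[OF u f m(1)] by simp
    then show "f \<odot> u = zero C x b" by (rule mono_zero[OF m(2,1) comp_arrow[OF u f]])
  next
    assume "f \<odot> u = zero C x b"
    then show "(m \<odot> f) \<odot> u = zero C x d"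
      using comp_assoc[OF u f m(1)] comp_zero[OF m(1)] arrows_obj[OF u] by simp
  qed
  show ?thesis
  proof (rule kernelI[OF ka mf kernel_mono[OF k]])
    show "(m \<odot> f) \<odot> k = zero C (dom C k) d" using iff[OF ka] kernel_zero[OF k ka f] by simp
    show "\<exists>v\<in>arrows C y (dom C k). k \<odot> v = u"
      if "u \<in> arrows C y a" "(m \<odot> f) \<odot> u = zero C y d" for y u
      using kernel_factor_unique[OF k ka f that(1) iffD1[OF iff[OF that(1)] that(2)]] by blast
  qed
qed

section \<open>Zero objects\<close>

lemma zero_object_arrow:
  assumes "zero_object C z"
  shows "f \<in> arrows C a z \<Longrightarrow> f = zero C a z" "f \<in> arrows C z a \<Longrightarrow> f = zero C z a"
proof -
  have z: "z \<in> obj C" using assms by (simp add: zero_object_def)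
  show "f = zero C a z" if f: "f \<in> arrows C a z"
  proof -
    have a: "a \<in> obj C" using arrows_obj[OF f] by simp
    then have "\<exists>!f. f \<in> arrows C a z" using assms by (simp add: zero_object_def)
    then show ?thesis using f zero_arrow[OF a z] by blast
  qed
  show "f = zero C z a" if f: "f \<in> arrows C z a"
  proof -
    have a: "a \<in> obj C" using arrows_obj[OF f] by simp
    then have "\<exists>!f. f \<in> arrows C z a" using assms by (simp add: zero_object_def)
    then show ?thesis using f zero_arrow[OF z a] by blast
  qed
qed

lemma is_mono_from_zero:
  assumes "zero_object C z" "a \<in> obj C"
  shows "is_mono C (zero C z a)"
proof -
  have "z \<in> obj C" using assms by (simp add: zero_object_def)
  then show ?thesis
    using zero_object_arrow(1)[OF assms(1)] by (intro monoI_zero[OF zero_arrow[OF _ assms(2)]]) auto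
qed

lemma is_epi_to_zero:
  assumes "zero_object C z" "a \<in> obj C"
  shows "is_epi C (zero C a z)"
proof -
  have "z \<in> obj C" using assms by (simp add: zero_object_def)
  then show ?thesis
    using zero_object_arrow(2)[OF assms(1)] by (intro epiI_zero[OF zero_arrow[OF assms(2)]]) auto
qed

lemma kernel_of_mono:
  assumes z: "zero_object C z" and m: "m \<in> arrows C a b" "is_mono C m"
  shows "is_kernel C (zero C z a) m"
proof -
  have zo: "z \<in> obj C" using z by (simp add: zero_object_def)
  have za: "zero C z a \<in> arrows C z a" using zero_arrow[OF zo] arrows_obj[OF m(1)] by blast
  show ?thesis
  proof (rule kernelI[OF za m(1) is_mono_from_zero[OF z]])
    show "a \<in> obj C" using arrows_obj[OF m(1)] by simp
    show "m \<odot> zero C z a = zero C z b" using comp_zero[OF m(1) zo] .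
    fix y u assume u: "u \<in> arrows C y a" "m \<odot> u = zero C y b"
    have yz: "zero C y z \<in> arrows C y z" using zero_arrow[OF _ zo] arrows_obj[OF u(1)] by simp
    then have "zero C z a \<odot> zero C y z = u"
      unfolding mono_zero[OF m(2,1) u] using zero_comp[OF yz] arrows_obj[OF m(1)] by simp
    then show "\<exists>v\<in>arrows C y z. zero C z a \<odot> v = u" using yz by blast
  qed
qed

lemma cokernel_of_epi:
  assumes z: "zero_object C z" and e: "e \<in> arrows C a b" "is_epi C e"
  shows "is_cokernel C (zero C b z) e"
proof -
  have zo: "z \<in> obj C" using z by (simp add: zero_object_def)
  have bz: "zero C b z \<in> arrows C b z" using zero_arrow[OF _ zo] arrows_obj[OF e(1)] by blast
  show ?thesis
  proof (rule cokernelI[OF bz e(1) is_epi_to_zero[OF z]])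
    show "b \<in> obj C" using arrows_obj[OF e(1)] by simp
    show "zero C b z \<odot> e = zero C a z" using zero_comp[OF e(1) zo] .
    fix y u assume u: "u \<in> arrows C b y" "u \<odot> e = zero C a y"
    have zy: "zero C z y \<in> arrows C z y" using zero_arrow[OF zo] arrows_obj[OF u(1)] by simp
    then have "zero C z y \<odot> zero C b z = u"
      unfolding epi_zero[OF e(2,1) u] using comp_zero[OF zy] arrows_obj[OF e(1)] by simp
    then show "\<exists>v\<in>arrows C z y. v \<odot> zero C b z = u" using zy by blast
  qed
qed

lemma cokernel_from_zero:
  assumes z: "z \<in> obj C" and a: "a \<in> obj C"
  shows "is_cokernel C (ident C a) (zero C z a)"
  using zero_arrow[OF z a]
  by (intro cokernelI[OF ident_arrow[OF a] zero_arrow[OF z a] epi_ident[OF a]])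
    (auto simp: comp_ident_left comp_ident_right)

lemma kernel_to_zero:
  assumes a: "a \<in> obj C" and z: "z \<in> obj C"
  shows "is_kernel C (ident C a) (zero C a z)"
  using zero_arrow[OF a z]
  by (intro kernelI[OF ident_arrow[OF a] zero_arrow[OF a z] mono_ident[OF a]])
    (auto simp: comp_ident_left comp_ident_right)

end

section \<open>Monos as kernels and epis as cokernels\<close>

context abelian_category
begin

text \<open>Some \<open>f\<close> has \<open>m\<close> as its kernel, and \<open>f\<close> factors
  through the cokernel \<open>c\<close> because it kills \<open>m\<close>. So whatever
  \<open>c\<close> kills is killed by \<open>f\<close> and factors through \<open>m\<close>.\<close>

lemma mono_kernel_cokernel:
  assumes "is_mono C m" "is_cokernel C c m"
  shows "is_kernel C m c"
proof -
  obtain f where f: "is_kernel C m f" using mono_is_kernel[OF assms(1)] by blast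
  define x a b d where "x = dom C m" and "a = cod C m" and "b = cod C f" and "d = cod C c"
  have m: "m \<in> arrows C x a" and fa: "f \<in> arrows C a b" and c: "c \<in> arrows C a d"
    using f assms(2)
    by (simp_all add: is_kernel_def is_cokernel_def arrows_def x_def a_def b_def d_def)
  obtain t where t: "t \<in> arrows C d b" "t \<odot> c = f"
    using cokernel_factor[OF assms(2) m c fa kernel_zero[OF f m fa]] .
  show ?thesis
  proof (rule kernelI[OF m c assms(1) cokernel_zero[OF assms(2) m c]])
    fix y u assume u: "u \<in> arrows C y a" "c \<odot> u = zero C y d"
    have "f \<odot> u = zero C y b"
      using comp_assoc[OF u(1) c t(1)] t(2) u(2) comp_zero[OF t(1)] arrows_obj[OF u(1)] by simp
    then show "\<exists>v\<in>arrows C y x. m \<odot> v = u" using kernel_factor_unique[OF f m fa u(1)] by blast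
  qed
qed

lemma epi_cokernel_kernel:
  assumes "is_epi C e" "is_kernel C k e"
  shows "is_cokernel C e k"
proof -
  obtain f where f: "is_cokernel C e f" using epi_is_cokernel[OF assms(1)] by blast
  define x a b d where "x = cod C e" and "a = dom C e" and "b = dom C f" and "d = dom C k"
  have e: "e \<in> arrows C a x" and fa: "f \<in> arrows C b a" and k: "k \<in> arrows C d a"
    using f assms(2)
    by (simp_all add: is_kernel_def is_cokernel_def arrows_def x_def a_def b_def d_def)
  obtain t where t: "t \<in> arrows C b d" "k \<odot> t = f"
    using kernel_factor[OF assms(2) k e fa cokernel_zero[OF f fa e]] .
  show ?thesis
  proof (rule cokernelI[OF e k assms(1) kernel_zero[OF assms(2) k e]])
    fix y u assume u: "u \<in> arrows C a y" "u \<odot> k = zero C d y"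
    have "u \<odot> f = zero C b y"
      using comp_assoc[OF t(1) k u(1)] t(2) u(2) zero_comp[OF t(1)] arrows_obj[OF u(1)] by simp
    then show "\<exists>v\<in>arrows C x y. v \<odot> e = u" using cokernel_factor_unique[OF f fa e u(1)] by blast
  qed
qed

text \<open>The cokernel of an epi is a zero arrow, so it kills the identity of \<open>b\<close>.
  Since \<open>f\<close> is the kernel of its cokernel, the identity factors through
  \<open>f\<close>; this right inverse is two-sided as \<open>f\<close> is mono.\<close>

lemma mono_epi_iso:
  assumes f: "f \<in> arrows C a b" and "is_mono C f" "is_epi C f"
  shows "iso_objects C a b"
proof -
  have a: "a \<in> obj C" and b: "b \<in> obj C" using arrows_obj[OF f] by auto
  obtain c where c: "is_cokernel C c f" using cokernel_exists arrowsD[OF f] by blast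
  have ca: "c \<in> arrows C b (cod C c)" using cokernel_arrows[OF c f] .
  have "c = zero C b (cod C c)" by (rule epi_zero[OF assms(3) f ca cokernel_zero[OF c f ca]])
  then have "c \<odot> ident C b = zero C b (cod C c)" using comp_ident_right[OF ca] by simp
  then obtain g where g: "g \<in> arrows C b a" "f \<odot> g = ident C b"
    by (rule kernel_factor[OF mono_kernel_cokernel[OF assms(2) c] f ca ident_arrow[OF b]])
  have "f \<odot> (g \<odot> f) = f \<odot> ident C a"
    using comp_assoc[OF f g(1) f] g(2) comp_ident_left[OF f] comp_ident_right[OF f] by simp
  then have "g \<odot> f = ident C a"
    by (rule monoD[OF assms(2) f comp_arrow[OF f g(1)] ident_arrow[OF a]])
  then show ?thesis using a b f g by (auto simp: iso_objects_def)
qed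

section \<open>Exactness\<close>

lemma exact_at_comp:
  assumes f: "f \<in> arrows C a b" and g: "g \<in> arrows C b c" and "exact_at C f g"
  shows "g \<odot> f = zero C a c"
proof -
  obtain m q where q: "is_cokernel C q f" and mq: "is_kernel C m q" and mg: "is_kernel C m g"
    using assms(3) by (auto simp: exact_at_def is_image_def)
  have qa: "q \<in> arrows C b (cod C q)" using cokernel_arrows[OF q f] .
  have ma: "m \<in> arrows C (dom C m) b" using kernel_arrows[OF mq qa] .
  obtain t where t: "t \<in> arrows C a (dom C m)" "m \<odot> t = f"
    using kernel_factor[OF mq ma qa f cokernel_zero[OF q f qa]] .
  show ?thesis
    using comp_assoc[OF t(1) ma g] t kernel_zero[OF mg ma g] zero_comp[OF t(1)] arrows_obj[OF g]
    by simp
qed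

text \<open>A cokernel \<open>c\<close> of a zero arrow has a left inverse, since the identity
  factors through it. An arrow \<open>u\<close> killed by \<open>f\<close> comes from the image of
  the zero arrow, so \<open>c\<close> kills it too, and the left inverse gives that \<open>u\<close>
  is zero.\<close>

lemma exact_at_from_zero_iff:
  assumes z: "zero_object C z" and f: "f \<in> arrows C a b"
  shows "exact_at C (zero C z a) f \<longleftrightarrow> is_mono C f"
proof
  have zo: "z \<in> obj C" and a: "a \<in> obj C" using z arrows_obj[OF f] by (auto simp: zero_object_def)
  have za: "zero C z a \<in> arrows C z a" using zero_arrow[OF zo a] .
  show "is_mono C f" if ex: "exact_at C (zero C z a) f"
  proof (rule monoI_zero[OF f])
    fix x u assume u: "u \<in> arrows C x a" "f \<odot> u = zero C x b"
    obtain m c where c: "is_cokernel C c (zero C z a)" and mc: "is_kernel C m c"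
      and mf: "is_kernel C m f"
      using ex by (auto simp: exact_at_def is_image_def)
    have ca: "c \<in> arrows C a (cod C c)" using cokernel_arrows[OF c za] .
    have ma: "m \<in> arrows C (dom C m) a" using kernel_arrows[OF mf f] .
    obtain v where v: "v \<in> arrows C x (dom C m)" "m \<odot> v = u" using kernel_factor[OF mf ma f u] .
    obtain t where t: "t \<in> arrows C (cod C c) a" "t \<odot> c = ident C a"
      using cokernel_factor[OF c za ca ident_arrow[OF a] comp_zero[OF ident_arrow[OF a] zo]] .
    have "c \<odot> u = zero C x (cod C c)"
      using comp_assoc[OF v(1) ma ca] v(2) kernel_zero[OF mc ma ca] zero_comp[OF v(1)]
        arrows_obj[OF ca] by simp
    then show "u = zero C x a"
      using comp_assoc[OF u(1) ca t(1)] t comp_ident_left[OF u(1)] comp_zero[OF t(1)]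
        arrows_obj[OF u(1)] by simp
  qed
  show "exact_at C (zero C z a) f" if "is_mono C f"
    using cokernel_from_zero[OF zo a] kernel_of_mono[OF z ident_arrow[OF a] mono_ident[OF a]]
      kernel_of_mono[OF z f that] arrowsD[OF za] arrowsD[OF f]
    unfolding exact_at_def is_image_def by auto
qed

text \<open>Dual argument: a kernel \<open>m\<close> of a zero arrow has a right inverse, and an
  arrow that kills \<open>g\<close> factors through the cokernel of \<open>g\<close> and so kills
  the image \<open>m\<close>.\<close>

lemma exact_at_to_zero_iff:
  assumes z: "zero_object C z" and g: "g \<in> arrows C a b"
  shows "exact_at C g (zero C b z) \<longleftrightarrow> is_epi C g"
proof
  have zo: "z \<in> obj C" and b: "b \<in> obj C" using z arrows_obj[OF g] by (auto simp: zero_object_def)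
  have bz: "zero C b z \<in> arrows C b z" using zero_arrow[OF b zo] .
  show "is_epi C g" if ex: "exact_at C g (zero C b z)"
  proof (rule epiI_zero[OF g])
    fix x u assume u: "u \<in> arrows C b x" "u \<odot> g = zero C a x"
    obtain m c where c: "is_cokernel C c g" and mc: "is_kernel C m c"
      and mz: "is_kernel C m (zero C b z)"
      using ex by (auto simp: exact_at_def is_image_def)
    have ca: "c \<in> arrows C b (cod C c)" using cokernel_arrows[OF c g] .
    have ma: "m \<in> arrows C (dom C m) b" using kernel_arrows[OF mz bz] .
    obtain v where v: "v \<in> arrows C (cod C c) x" "v \<odot> c = u" using cokernel_factor[OF c g ca u] .
    obtain t where t: "t \<in> arrows C b (dom C m)" "m \<odot> t = ident C b"
      using kernel_factor[OF mz ma bz ident_arrow[OF b] zero_comp[OF ident_arrow[OF b] zo]] .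
    have "u \<odot> m = zero C (dom C m) x"
      using comp_assoc[OF ma ca v(1)] v(2) kernel_zero[OF mc ma ca] comp_zero[OF v(1)]
        arrows_obj[OF ma] by simp
    then show "u = zero C b x"
      using comp_assoc[OF t(1) ma u(1)] t comp_ident_right[OF u(1)] zero_comp[OF t(1)]
        arrows_obj[OF u(1)] by simp
  qed
  show "exact_at C g (zero C b z)" if "is_epi C g"
    using cokernel_of_epi[OF z g that] kernel_to_zero[OF b zo] arrowsD[OF bz] arrowsD[OF g]
    unfolding exact_at_def is_image_def by auto
qed

text \<open>An arrow that kills \<open>f\<close> factors through the cokernel of \<open>f\<close>,
  so it kills the image \<open>m\<close>. By exactness \<open>m\<close> is also a kernel of
  \<open>g\<close>, and the epi \<open>g\<close> is the cokernel of its kernel.\<close>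

lemma exact_at_mono_epi_iff:
  assumes f: "f \<in> arrows C a b" "is_mono C f" and g: "g \<in> arrows C b c" "is_epi C g"
  shows "exact_at C f g \<longleftrightarrow> is_cokernel C g f"
proof
  assume ex: "exact_at C f g"
  obtain m q where q: "is_cokernel C q f" and mq: "is_kernel C m q" and mg: "is_kernel C m g"
    using ex by (auto simp: exact_at_def is_image_def)
  have qa: "q \<in> arrows C b (cod C q)" using cokernel_arrows[OF q f(1)] .
  have ma: "m \<in> arrows C (dom C m) b" using kernel_arrows[OF mq qa] .
  show "is_cokernel C g f"
  proof (rule cokernelI[OF g(1) f(1) g(2) exact_at_comp[OF f(1) g(1) ex]])
    fix y u assume u: "u \<in> arrows C b y" "u \<odot> f = zero C a y"
    obtain t where t: "t \<in> arrows C (cod C q) y" "t \<odot> q = u" using cokernel_factor[OF q f(1) qa u] .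
    have "u \<odot> m = zero C (dom C m) y"
      using comp_assoc[OF ma qa t(1)] t(2) kernel_zero[OF mq ma qa] comp_zero[OF t(1)]
        arrows_obj[OF ma] by simp
    then show "\<exists>v\<in>arrows C c y. v \<odot> g = u"
      using cokernel_factor_unique[OF epi_cokernel_kernel[OF g(2) mg] ma g(1) u(1)] by blast
  qed
next
  assume "is_cokernel C g f"
  then show "exact_at C f g"
    using mono_kernel_cokernel[OF f(2)] arrowsD[OF f(1)] arrowsD[OF g(1)]
    unfolding exact_at_def is_image_def by auto
qed

text \<open>The working form of short exactness: no zero object is left in it, and exactness in the
  middle has become a universal property.\<close>

lemma short_exact_iff:
  "short_exact C a f b g c \<longleftrightarrow>
    f \<in> arrows C a b \<and> g \<in> arrows C b c \<and> is_mono C f \<and> is_cokernel C g f"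
proof (cases "f \<in> arrows C a b \<and> g \<in> arrows C b c")
  case True
  then have f: "f \<in> arrows C a b" and g: "g \<in> arrows C b c" by auto
  have "exact_sequence C [zero C z a, f, g, zero C c z] \<longleftrightarrow> is_mono C f \<and> is_cokernel C g f"
    if z: "zero_object C z" for z
  proof -
    have "exact_sequence C [zero C z a, f, g, zero C c z] \<longleftrightarrow>
      exact_at C (zero C z a) f \<and> exact_at C f g \<and> exact_at C g (zero C c z)"
      unfolding exact_sequence_def by (auto simp: less_Suc_eq nth_Cons split: nat.splits)
    then show ?thesis
      using exact_at_from_zero_iff[OF z f] exact_at_to_zero_iff[OF z g] cokernel_epi
        exact_at_mono_epi_iff[OF f _ g] by blast
  qed
  then show ?thesis using True zero_object_exists unfolding short_exact_def by blast
qed (auto simp: short_exact_def)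

section \<open>Working with short exact sequences\<close>

lemma short_exact_epi: "short_exact C a f b g c \<Longrightarrow> is_epi C g"
  using cokernel_epi by (auto simp: short_exact_iff)

lemma short_exact_kernel: "short_exact C a f b g c \<Longrightarrow> is_kernel C f g"
  using mono_kernel_cokernel by (auto simp: short_exact_iff)

lemma short_exact_comp: "short_exact C a f b g c \<Longrightarrow> g \<odot> f = zero C a c"
  using cokernel_zero by (auto simp: short_exact_iff)

lemma mono_short_exact:
  assumes "f \<in> arrows C a b" "is_mono C f"
  obtains g c where "short_exact C a f b g c"
proof -
  obtain g where g: "is_cokernel C g f" using cokernel_exists arrowsD[OF assms(1)] by blast
  have "short_exact C a f b g (cod C g)"
    using assms g cokernel_arrows[OF g assms(1)] by (simp add: short_exact_iff)
  then show thesis by (rule that)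
qed

lemma short_exact_factor:
  assumes "short_exact C a f b g c" "u \<in> arrows C b x" "u \<odot> f = zero C a x"
  obtains v where "v \<in> arrows C c x" "v \<odot> g = u"
proof -
  have "is_cokernel C g f" "f \<in> arrows C a b" "g \<in> arrows C b c"
    using assms(1) by (simp_all add: short_exact_iff)
  then show thesis using assms(2,3) by (rule cokernel_factor) (rule that)
qed

lemma short_exactI:
  assumes f: "f \<in> arrows C a b" "is_mono C f" and g: "g \<in> arrows C b c" "is_epi C g"
    and "g \<odot> f = zero C a c"
    and "\<And>y u. \<lbrakk>u \<in> arrows C b y; u \<odot> f = zero C a y\<rbrakk> \<Longrightarrow> \<exists>v\<in>arrows C c y. v \<odot> g = u"
  shows "short_exact C a f b g c"
  using cokernelI[OF g(1) f(1) g(2) assms(5,6)] f g by (simp add: short_exact_iff)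

lemma short_exact_to_zero:
  assumes "zero_object C z" "a \<in> obj C"
  shows "short_exact C a (ident C a) a (zero C a z) z"
proof -
  have "z \<in> obj C" using assms by (simp add: zero_object_def)
  then show ?thesis
    using cokernel_of_epi[OF assms(1) ident_arrow[OF assms(2)] epi_ident[OF assms(2)]]
      mono_ident[OF assms(2)] ident_arrow[OF assms(2)] zero_arrow[OF assms(2)]
    by (simp add: short_exact_iff)
qed

text \<open>The coimage factorisation. To see that \<open>d'\<close> is mono, let it kill
  \<open>u\<close> and let \<open>r\<close> be the cokernel of \<open>u\<close>. Then
  \<open>d\<close> factors through \<open>r \<odot> c\<close>, so the kernel of
  \<open>r \<odot> c\<close> lies inside that of \<open>d\<close>, which \<open>c\<close> kills. As
  \<open>r \<odot> c\<close> is the cokernel of its kernel, \<open>c\<close> factors through it;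
  cancelling \<open>c\<close> gives \<open>r\<close> a left inverse, and
  \<open>r \<odot> u = 0\<close> leaves only \<open>u = 0\<close>.\<close>

lemma epi_mono_factorisation:
  assumes c: "is_cokernel C c m" and m: "is_kernel C m d"
    and ca: "c \<in> arrows C a q" and da: "d \<in> arrows C a b"
  obtains d' where "d' \<in> arrows C q b" "is_mono C d'" "d' \<odot> c = d"
proof -
  have ma: "m \<in> arrows C (dom C m) a" using kernel_arrows[OF m da] .
  obtain d' where d': "d' \<in> arrows C q b" "d' \<odot> c = d"
    using cokernel_factor[OF c ma ca da kernel_zero[OF m ma da]] .
  have qo: "q \<in> obj C" using arrows_obj[OF ca] by simp
  have "is_mono C d'"
  proof (rule monoI_zero[OF d'(1)])
    fix x u assume u: "u \<in> arrows C x q" "d' \<odot> u = zero C x b"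
    obtain r where r: "is_cokernel C r u" using cokernel_exists arrowsD[OF u(1)] by blast
    define p where "p = cod C r"
    have ra: "r \<in> arrows C q p" using cokernel_arrows[OF r u(1)] p_def by simp
    obtain e where e: "e \<in> arrows C p b" "e \<odot> r = d'" using cokernel_factor[OF r u(1) ra d'(1) u(2)] .
    have rc: "r \<odot> c \<in> arrows C a p" using ca ra by (rule comp_arrow)
    obtain l where l: "is_kernel C l (r \<odot> c)" using kernel_exists arrowsD[OF rc] by blast
    define y where "y = dom C l"
    have la: "l \<in> arrows C y a" using kernel_arrows[OF l rc] y_def by simp
    have "d = e \<odot> (r \<odot> c)" using comp_assoc[OF ca ra e(1)] e d' by simp
    then have "d \<odot> l = zero C y b"
      using comp_assoc[OF la rc e(1)] kernel_zero[OF l la rc] comp_zero[OF e(1)] arrows_obj[OF la]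
      by simp
    then obtain t where t: "t \<in> arrows C y (dom C m)" "m \<odot> t = l"
      by (rule kernel_factor[OF m ma da la])
    have "c \<odot> l = zero C y q"
      using comp_assoc[OF t(1) ma ca] t cokernel_zero[OF c ma ca] zero_comp[OF t(1) qo] by simp
    moreover have "is_cokernel C (r \<odot> c) l"
      using epi_cokernel_kernel[OF epi_comp[OF cokernel_epi[OF c] cokernel_epi[OF r] ca ra] l] .
    ultimately obtain s where s: "s \<in> arrows C p q" "s \<odot> (r \<odot> c) = c"
      using cokernel_factor[OF _ la rc ca] by blast
    have "(s \<odot> r) \<odot> c = ident C q \<odot> c"
      using comp_assoc[OF ca ra s(1)] s(2) comp_ident_left[OF ca] by simp
    then have "s \<odot> r = ident C q"
      by (rule epiD[OF cokernel_epi[OF c] ca comp_arrow[OF ra s(1)] ident_arrow[OF qo]])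
    then show "u = zero C x q"
      using comp_assoc[OF u(1) ra s(1)] comp_ident_left[OF u(1)] cokernel_zero[OF r u(1) ra]
        comp_zero[OF s(1)] arrows_obj[OF u(1)] by simp
  qed
  then show thesis using d' that by blast
qed

section \<open>Injective objects and diagram lemmas\<close>

lemma injective_extend:
  assumes "injective_object C e" "is_mono C m" "m \<in> arrows C a b" "f \<in> arrows C a e"
  obtains g where "g \<in> arrows C b e" "g \<odot> m = f"
proof -
  have "dom C m = a" "cod C m = b" using arrowsD[OF assms(3)] by auto
  then show thesis using assms(1,2,4) that unfolding injective_object_def by blast
qed

text \<open>With enough injectives, monomorphisms are detected without pullbacks.\<close>

lemma mono_if_injectives_extend:
  assumes "enough_injectives C" "u \<in> arrows C a b"
    and "\<And>e j. \<lbrakk>injective_object C e; j \<in> arrows C a e\<rbrakk> \<Longrightarrow> \<exists>w\<in>arrows C b e. w \<odot> u = j"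
  shows "is_mono C u"
proof -
  obtain e j where "injective_object C e" and j: "j \<in> arrows C a e" "is_mono C j"
    using assms(1,2) arrows_obj unfolding enough_injectives_def by blast
  then obtain w where "w \<in> arrows C b e" "w \<odot> u = j" using assms(3) by blast
  then show ?thesis using mono_cancel[OF _ assms(2)] j by blast
qed

text \<open>With \<open>a\<close> inside \<open>b\<close> inside \<open>x\<close>, this is the third
  isomorphism theorem: \<open>b/a\<close> embeds into \<open>x/a\<close> with cokernel
  \<open>x/b\<close>. For \<open>u\<close> to be mono, an arrow \<open>j\<close> from
  \<open>b/a\<close> to an injective object is pulled back to \<open>b\<close> and extended to
  \<open>x\<close>; the extension vanishes on \<open>a\<close>, so it descends to
  \<open>x/a\<close>.\<close>

lemma short_exact_mono_comp:
  assumes inj: "enough_injectives C"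
    and F: "short_exact C a f b p c" and G: "short_exact C b g x q n"
  obtains r d u v where "short_exact C a (g \<odot> f) x r d" "short_exact C c u d v n"
proof -
  have f: "f \<in> arrows C a b" "is_mono C f" and p: "p \<in> arrows C b c"
    and g: "g \<in> arrows C b x" "is_mono C g" and q: "q \<in> arrows C x n"
    using F G by (auto simp: short_exact_iff)
  have gf: "g \<odot> f \<in> arrows C a x" using f(1) g(1) by (rule comp_arrow)
  have objs: "a \<in> obj C" "b \<in> obj C" "c \<in> obj C" "x \<in> obj C" "n \<in> obj C"
    using arrows_obj f p g q by blast+
  obtain r d where R: "short_exact C a (g \<odot> f) x r d"
    using mono_short_exact[OF gf mono_comp[OF f(2) g(2) f(1) g(1)]] .
  have r: "r \<in> arrows C x d" using R by (simp add: short_exact_iff)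
  have rg: "r \<odot> g \<in> arrows C b d" using g(1) r by (rule comp_arrow)
  have "(r \<odot> g) \<odot> f = zero C a d" using comp_assoc[OF f(1) g(1) r] short_exact_comp[OF R] by simp
  then obtain u where u: "u \<in> arrows C c d" "u \<odot> p = r \<odot> g" by (rule short_exact_factor[OF F rg])
  have "q \<odot> (g \<odot> f) = zero C a n"
    using comp_assoc[OF f(1) g(1) q] short_exact_comp[OF G] zero_comp[OF f(1)] objs by simp
  then obtain v where v: "v \<in> arrows C d n" "v \<odot> r = q" by (rule short_exact_factor[OF R q])
  have "short_exact C c u d v n"
  proof (rule short_exactI[OF u(1) _ v(1)])
    show "is_mono C u"
    proof (rule mono_if_injectives_extend[OF inj u(1)])
      fix e j assume e: "injective_object C e" and j: "j \<in> arrows C c e"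
      have jp: "j \<odot> p \<in> arrows C b e" using p j by (rule comp_arrow)
      obtain y where y: "y \<in> arrows C x e" "y \<odot> g = j \<odot> p" using injective_extend[OF e g(2,1) jp] .
      have "y \<odot> (g \<odot> f) = zero C a e"
        using comp_assoc[OF f(1) g(1) y(1)] y(2) comp_assoc[OF f(1) p j] short_exact_comp[OF F]
          comp_zero[OF j] objs by simp
      then obtain w where w: "w \<in> arrows C d e" "w \<odot> r = y" by (rule short_exact_factor[OF R y(1)])
      have "(w \<odot> u) \<odot> p = j \<odot> p"
        using comp_assoc[OF p u(1) w(1)] u(2) comp_assoc[OF g(1) r w(1)] w(2) y(2) by simp
      then have "w \<odot> u = j" by (rule epiD[OF short_exact_epi[OF F] p comp_arrow[OF u(1) w(1)] j])
      then show "\<exists>w\<in>arrows C d e. w \<odot> u = j" using w(1) by blast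
    qed
    show "is_epi C v" using epi_cancel[OF _ r v(1)] v(2) short_exact_epi[OF G] by simp
    have "(v \<odot> u) \<odot> p = zero C b n"
      using comp_assoc[OF p u(1) v(1)] u(2) comp_assoc[OF g(1) r v(1)] v(2) short_exact_comp[OF G] by simp
    then show "v \<odot> u = zero C c n"
      by (rule epi_zero[OF short_exact_epi[OF F] p comp_arrow[OF u(1) v(1)]])
    fix y w assume w: "w \<in> arrows C d y" "w \<odot> u = zero C c y"
    have wr: "w \<odot> r \<in> arrows C x y" using r w(1) by (rule comp_arrow)
    have "(w \<odot> r) \<odot> g = zero C b y"
      using comp_assoc[OF g(1) r w(1)] u(2) comp_assoc[OF p u(1) w(1)] w(2) zero_comp[OF p]
        arrows_obj[OF w(1)] by simp
    then obtain t where t: "t \<in> arrows C n y" "t \<odot> q = w \<odot> r" by (rule short_exact_factor[OF G wr])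
    have "(t \<odot> v) \<odot> r = w \<odot> r" using comp_assoc[OF r v(1) t(1)] v(2) t(2) by simp
    then have "t \<odot> v = w" by (rule epiD[OF short_exact_epi[OF R] r comp_arrow[OF v(1) t(1)] w(1)])
    then show "\<exists>t\<in>arrows C n y. t \<odot> v = w" using t(1) by blast
  qed
  then show thesis by (rule that[OF R])
qed

text \<open>If \<open>u\<close> kills \<open>i\<close>, the decomposition of the identity of
  \<open>s\<close> leaves \<open>u = (u \<odot> j) \<odot> q\<close>, which is the factorisation
  required of a cokernel.\<close>

lemma direct_sum_short_exact:
  assumes i: "i \<in> arrows C a s" and j: "j \<in> arrows C b s"
    and p: "p \<in> arrows C s a" and q: "q \<in> arrows C s b"
    and pi: "p \<odot> i = ident C a" and qj: "q \<odot> j = ident C b"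
    and qi: "q \<odot> i = zero C a b" and sum: "(i \<odot> p) \<boxplus> (j \<odot> q) = ident C s"
  shows "short_exact C a i s q b"
proof (rule short_exactI[OF i _ q _ qi])
  have objs: "a \<in> obj C" "b \<in> obj C" using arrows_obj i j by blast+
  show "is_mono C i" using mono_cancel[OF _ i p] pi mono_ident[OF objs(1)] by simp
  show "is_epi C q" using epi_cancel[OF _ j q] qj epi_ident[OF objs(2)] by simp
  fix y u assume u: "u \<in> arrows C s y" "u \<odot> i = zero C a y"
  have ip: "i \<odot> p \<in> arrows C s s" using p i by (rule comp_arrow)
  have jq: "j \<odot> q \<in> arrows C s s" using q j by (rule comp_arrow)
  have uj: "u \<odot> j \<in> arrows C b y" using j u(1) by (rule comp_arrow)
  have "u = u \<odot> ((i \<odot> p) \<boxplus> (j \<odot> q))" using sum comp_ident_right[OF u(1)] by simp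
  also have "\<dots> = (u \<odot> (i \<odot> p)) \<boxplus> (u \<odot> (j \<odot> q))" by (rule comp_plus_right[OF ip jq u(1)])
  also have "u \<odot> (i \<odot> p) = zero C s y"
    using comp_assoc[OF p i u(1)] u(2) zero_comp[OF p] arrows_obj[OF u(1)] by simp
  also have "u \<odot> (j \<odot> q) = (u \<odot> j) \<odot> q" using comp_assoc[OF q j u(1)] by simp
  also have "zero C s y \<boxplus> ((u \<odot> j) \<odot> q) = (u \<odot> j) \<odot> q"
    by (rule plus_zero(2)[OF comp_arrow[OF q uj]])
  finally have "(u \<odot> j) \<odot> q = u" by (rule sym)
  then show "\<exists>v\<in>arrows C b y. v \<odot> q = u" using uj by blast
qed

text \<open>
  Horseshoe lemma: \<open>m = (e, h3 \<odot> g)\<close>, where \<open>e\<close> extends \<open>h1\<close> along \<open>f\<close>. That the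
  induced \<open>u\<close> is mono is again tested against arrows \<open>j\<close> into injectives:
  \<open>j \<odot> p1 \<odot> e\<close> vanishes on \<open>f\<close>, so it comes from \<open>a3\<close>, and its negative extends
  along \<open>h3\<close>.
\<close>

lemma horseshoe:
  assumes inj: "enough_injectives C" and e1: "injective_object C e1"
    and F: "short_exact C a1 f a2 g a3"
    and H1: "short_exact C a1 h1 e1 p1 n1" and H3: "short_exact C a3 h3 x3 p3 n3"
    and S: "is_direct_sum C s e1 x3"
  obtains m r q u v where "short_exact C a2 m s r q" "short_exact C n1 u q v n3"
proof -
  obtain i j \<pi> \<rho> where i: "i \<in> arrows C e1 s" and j: "j \<in> arrows C x3 s"
    and \<pi>: "\<pi> \<in> arrows C s e1" and \<rho>: "\<rho> \<in> arrows C s x3"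
    and \<pi>i: "\<pi> \<odot> i = ident C e1" and \<rho>j: "\<rho> \<odot> j = ident C x3"
    and \<pi>j: "\<pi> \<odot> j = zero C x3 e1" and \<rho>i: "\<rho> \<odot> i = zero C e1 x3"
    and sum: "(i \<odot> \<pi>) \<boxplus> (j \<odot> \<rho>) = ident C s"
    using S unfolding is_direct_sum_def by blast
  have f: "f \<in> arrows C a1 a2" "is_mono C f" and g: "g \<in> arrows C a2 a3"
    and h1: "h1 \<in> arrows C a1 e1" "is_mono C h1" and p1: "p1 \<in> arrows C e1 n1"
    and h3: "h3 \<in> arrows C a3 x3" "is_mono C h3" and p3: "p3 \<in> arrows C x3 n3"
    using F H1 H3 by (simp_all add: short_exact_iff)
  have objs: "a1 \<in> obj C" "a2 \<in> obj C" "a3 \<in> obj C" "e1 \<in> obj C" "x3 \<in> obj C"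
    "n1 \<in> obj C" "n3 \<in> obj C" "s \<in> obj C"
    using arrows_obj[OF f(1)] arrows_obj[OF g] arrows_obj[OF p1] arrows_obj[OF p3] arrows_obj[OF i]
    by simp_all
  obtain e where e: "e \<in> arrows C a2 e1" "e \<odot> f = h1" using injective_extend[OF e1 f(2,1) h1(1)] .
  define k where "k = h3 \<odot> g"
  have k: "k \<in> arrows C a2 x3" unfolding k_def using g h3(1) by (rule comp_arrow)
  have ie: "i \<odot> e \<in> arrows C a2 s" using e(1) i by (rule comp_arrow)
  have jk: "j \<odot> k \<in> arrows C a2 s" using k j by (rule comp_arrow)
  define m where "m = (i \<odot> e) \<boxplus> (j \<odot> k)"
  have m: "m \<in> arrows C a2 s" unfolding m_def using ie jk by (rule plus_arrow)
  have \<pi>m: "\<pi> \<odot> m = e"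
  proof -
    have "\<pi> \<odot> m = (\<pi> \<odot> (i \<odot> e)) \<boxplus> (\<pi> \<odot> (j \<odot> k))"
      unfolding m_def by (rule comp_plus_right[OF ie jk \<pi>])
    also have "\<pi> \<odot> (i \<odot> e) = e" using comp_assoc[OF e(1) i \<pi>] \<pi>i comp_ident_left[OF e(1)] by simp
    also have "\<pi> \<odot> (j \<odot> k) = zero C a2 e1"
      using comp_assoc[OF k j \<pi>] \<pi>j zero_comp[OF k] objs by simp
    also have "e \<boxplus> zero C a2 e1 = e" by (rule plus_zero(1)[OF e(1)])
    finally show ?thesis .
  qed
  have \<rho>m: "\<rho> \<odot> m = k"
  proof -
    have "\<rho> \<odot> m = (\<rho> \<odot> (i \<odot> e)) \<boxplus> (\<rho> \<odot> (j \<odot> k))"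
      unfolding m_def by (rule comp_plus_right[OF ie jk \<rho>])
    also have "\<rho> \<odot> (i \<odot> e) = zero C a2 x3"
      using comp_assoc[OF e(1) i \<rho>] \<rho>i zero_comp[OF e(1)] objs by simp
    also have "\<rho> \<odot> (j \<odot> k) = k" using comp_assoc[OF k j \<rho>] \<rho>j comp_ident_left[OF k] by simp
    also have "zero C a2 x3 \<boxplus> k = k" by (rule plus_zero(2)[OF k])
    finally show ?thesis .
  qed
  have kf: "k \<odot> f = zero C a1 x3"
    unfolding k_def
    using comp_assoc[OF f(1) g h3(1)] short_exact_comp[OF F] comp_zero[OF h3(1)] objs by simp
  have mf: "m \<odot> f = i \<odot> h1"
  proof -
    have "m \<odot> f = ((i \<odot> e) \<odot> f) \<boxplus> ((j \<odot> k) \<odot> f)"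
      unfolding m_def by (rule comp_plus_left[OF f(1) ie jk])
    also have "(i \<odot> e) \<odot> f = i \<odot> h1" using comp_assoc[OF f(1) e(1) i] e(2) by simp
    also have "(j \<odot> k) \<odot> f = zero C a1 s"
      using comp_assoc[OF f(1) k j] kf comp_zero[OF j] objs by simp
    also have "(i \<odot> h1) \<boxplus> zero C a1 s = i \<odot> h1" by (rule plus_zero(1)[OF comp_arrow[OF h1(1) i]])
    finally show ?thesis .
  qed
  have "is_mono C m"
  proof (rule monoI_zero[OF m])
    \<comment> \<open>If \<open>m\<close> kills \<open>u\<close>, so do both components. The
      component \<open>k\<close> forces \<open>u\<close> into \<open>a1\<close>, as
      \<open>h3\<close> is mono; there \<open>e\<close> restricts to the mono
      \<open>h1\<close>.\<close>
    fix y u assume u: "u \<in> arrows C y a2" "m \<odot> u = zero C y s"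
    have y: "y \<in> obj C" using arrows_obj[OF u(1)] by simp
    have eu: "e \<odot> u = zero C y e1" using comp_assoc[OF u(1) m \<pi>] \<pi>m u(2) comp_zero[OF \<pi> y] by simp
    have "k \<odot> u = zero C y x3" using comp_assoc[OF u(1) m \<rho>] \<rho>m u(2) comp_zero[OF \<rho> y] by simp
    then have "h3 \<odot> (g \<odot> u) = zero C y x3" using comp_assoc[OF u(1) g h3(1)] k_def by simp
    then have "g \<odot> u = zero C y a3" by (rule mono_zero[OF h3(2,1) comp_arrow[OF u(1) g]])
    then obtain t where t: "t \<in> arrows C y a1" "f \<odot> t = u"
      by (rule kernel_factor[OF short_exact_kernel[OF F] f(1) g u(1)])
    have "h1 \<odot> t = zero C y e1" using comp_assoc[OF t(1) f(1) e(1)] e(2) t(2) eu by simp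
    then have "t = zero C y a1" by (rule mono_zero[OF h1(2,1) t(1)])
    then show "u = zero C y a2" using t(2) comp_zero[OF f(1) y] by simp
  qed
  then obtain r q where R: "short_exact C a2 m s r q" by (rule mono_short_exact[OF m])
  have r: "r \<in> arrows C s q" using R by (simp add: short_exact_iff)
  have q: "q \<in> obj C" using arrows_obj[OF r] by simp
  have ri: "r \<odot> i \<in> arrows C e1 q" using i r by (rule comp_arrow)
  have rj: "r \<odot> j \<in> arrows C x3 q" using j r by (rule comp_arrow)
  have "(r \<odot> i) \<odot> h1 = (r \<odot> m) \<odot> f"
    using comp_assoc[OF h1(1) i r] comp_assoc[OF f(1) m r] mf by simp
  also have "\<dots> = zero C a1 q" using short_exact_comp[OF R] zero_comp[OF f(1) q] by simp
  finally obtain u where u: "u \<in> arrows C n1 q" "u \<odot> p1 = r \<odot> i"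
    by (rule short_exact_factor[OF H1 ri])
  have p3\<rho>: "p3 \<odot> \<rho> \<in> arrows C s n3" using \<rho> p3 by (rule comp_arrow)
  have "(p3 \<odot> \<rho>) \<odot> m = (p3 \<odot> h3) \<odot> g"
    using comp_assoc[OF m \<rho> p3] \<rho>m comp_assoc[OF g h3(1) p3] k_def by simp
  also have "\<dots> = zero C a2 n3" using short_exact_comp[OF H3] zero_comp[OF g] objs by simp
  finally obtain v where v: "v \<in> arrows C q n3" "v \<odot> r = p3 \<odot> \<rho>"
    by (rule short_exact_factor[OF R p3\<rho>])
  have "short_exact C n1 u q v n3"
  proof (rule short_exactI[OF u(1) _ v(1)])
    show "is_mono C u"
    proof (rule mono_if_injectives_extend[OF inj u(1)])
      fix d l assume d: "injective_object C d" and l: "l \<in> arrows C n1 d"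
      have dob: "d \<in> obj C" using arrows_obj[OF l] by simp
      have lp: "l \<odot> p1 \<in> arrows C e1 d" using p1 l by (rule comp_arrow)
      have lpe: "(l \<odot> p1) \<odot> e \<in> arrows C a2 d" using e(1) lp by (rule comp_arrow)
      have "((l \<odot> p1) \<odot> e) \<odot> f = l \<odot> (p1 \<odot> h1)"
        using comp_assoc[OF f(1) e(1) lp] e(2) comp_assoc[OF h1(1) p1 l] by simp
      also have "\<dots> = zero C a1 d" using short_exact_comp[OF H1] comp_zero[OF l] objs by simp
      finally obtain t where t: "t \<in> arrows C a3 d" "t \<odot> g = (l \<odot> p1) \<odot> e"
        by (rule short_exact_factor[OF F lpe])
      obtain t' where t': "t' \<in> arrows C a3 d" "t \<boxplus> t' = zero C a3 d" using neg_exists[OF t(1)] .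
      obtain y where y: "y \<in> arrows C x3 d" "y \<odot> h3 = t'" using injective_extend[OF d h3(2,1) t'(1)] .
      \<comment> \<open>The second summand cancels the first on \<open>m\<close>: the sum becomes
        \<open>(t \<boxplus> t') \<odot> g = 0\<close>, so \<open>w\<close> descends to
        \<open>q\<close>. On the summand \<open>e1\<close> only \<open>l \<odot> p1\<close> remains,
        so the descended arrow restricts to \<open>l\<close> along \<open>u\<close>.\<close>
      define w where "w = ((l \<odot> p1) \<odot> \<pi>) \<boxplus> (y \<odot> \<rho>)"
      have lp\<pi>: "(l \<odot> p1) \<odot> \<pi> \<in> arrows C s d" using \<pi> lp by (rule comp_arrow)
      have y\<rho>: "y \<odot> \<rho> \<in> arrows C s d" using \<rho> y(1) by (rule comp_arrow)
      have w: "w \<in> arrows C s d" unfolding w_def using lp\<pi> y\<rho> by (rule plus_arrow)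
      have "w \<odot> m = (((l \<odot> p1) \<odot> \<pi>) \<odot> m) \<boxplus> ((y \<odot> \<rho>) \<odot> m)"
        unfolding w_def by (rule comp_plus_left[OF m lp\<pi> y\<rho>])
      also have "((l \<odot> p1) \<odot> \<pi>) \<odot> m = t \<odot> g" using comp_assoc[OF m \<pi> lp] \<pi>m t(2) by simp
      also have "(y \<odot> \<rho>) \<odot> m = t' \<odot> g"
        using comp_assoc[OF m \<rho> y(1)] \<rho>m k_def comp_assoc[OF g h3(1) y(1)] y(2) by simp
      also have "(t \<odot> g) \<boxplus> (t' \<odot> g) = zero C a2 d"
        using comp_plus_left[OF g t(1) t'(1)] t'(2) zero_comp[OF g dob] by simp
      finally obtain w' where w': "w' \<in> arrows C q d" "w' \<odot> r = w"
        by (rule short_exact_factor[OF R w])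
      have "(w' \<odot> u) \<odot> p1 = w \<odot> i"
        using comp_assoc[OF p1 u(1) w'(1)] u(2) comp_assoc[OF i r w'(1)] w'(2) by simp
      also have "\<dots> = (((l \<odot> p1) \<odot> \<pi>) \<odot> i) \<boxplus> ((y \<odot> \<rho>) \<odot> i)"
        unfolding w_def by (rule comp_plus_left[OF i lp\<pi> y\<rho>])
      also have "((l \<odot> p1) \<odot> \<pi>) \<odot> i = l \<odot> p1"
        using comp_assoc[OF i \<pi> lp] \<pi>i comp_ident_right[OF lp] by simp
      also have "(y \<odot> \<rho>) \<odot> i = zero C e1 d"
        using comp_assoc[OF i \<rho> y(1)] \<rho>i comp_zero[OF y(1)] objs by simp
      also have "(l \<odot> p1) \<boxplus> zero C e1 d = l \<odot> p1" by (rule plus_zero(1)[OF lp])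
      finally have "w' \<odot> u = l" by (rule epiD[OF short_exact_epi[OF H1] p1 comp_arrow[OF u(1) w'(1)] l])
      then show "\<exists>w\<in>arrows C q d. w \<odot> u = l" using w'(1) by blast
    qed
    have "is_epi C \<rho>" using epi_cancel[OF _ j \<rho>] \<rho>j epi_ident objs by simp
    then have "is_epi C (p3 \<odot> \<rho>)" using epi_comp[OF _ short_exact_epi[OF H3] \<rho> p3] by simp
    then show "is_epi C v" using epi_cancel[OF _ r v(1)] v(2) by simp
    have "(v \<odot> u) \<odot> p1 = (v \<odot> r) \<odot> i"
      using comp_assoc[OF p1 u(1) v(1)] u(2) comp_assoc[OF i r v(1)] by simp
    also have "\<dots> = zero C e1 n3" using v(2) comp_assoc[OF i \<rho> p3] \<rho>i comp_zero[OF p3] objs by simp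
    finally show "v \<odot> u = zero C n1 n3"
      by (rule epi_zero[OF short_exact_epi[OF H1] p1 comp_arrow[OF u(1) v(1)]])
    \<comment> \<open>Seen on \<open>s\<close>, the arrow \<open>w \<odot> r\<close> vanishes on
      \<open>e1\<close>, so it is determined by its restriction to \<open>x3\<close>. As it also
      vanishes on \<open>m\<close> and \<open>g\<close> is epi, this restriction kills
      \<open>h3\<close> and comes from an arrow \<open>t\<close> on \<open>n3\<close>.\<close>
    fix y w assume w: "w \<in> arrows C q y" "w \<odot> u = zero C n1 y"
    have yob: "y \<in> obj C" using arrows_obj[OF w(1)] by simp
    have wr: "w \<odot> r \<in> arrows C s y" using r w(1) by (rule comp_arrow)
    have wrj: "(w \<odot> r) \<odot> j \<in> arrows C x3 y" using j wr by (rule comp_arrow)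
    have wrjh: "((w \<odot> r) \<odot> j) \<odot> h3 \<in> arrows C a3 y" using h3(1) wrj by (rule comp_arrow)
    have wri: "(w \<odot> r) \<odot> i = zero C e1 y"
      using comp_assoc[OF i r w(1)] u(2) comp_assoc[OF p1 u(1) w(1)] w(2) zero_comp[OF p1 yob] by simp
    have wrm: "(w \<odot> r) \<odot> m = zero C a2 y"
      using comp_assoc[OF m r w(1)] short_exact_comp[OF R] comp_zero[OF w(1)] objs by simp
    have "(w \<odot> r) \<odot> m = ((w \<odot> r) \<odot> (i \<odot> e)) \<boxplus> ((w \<odot> r) \<odot> (j \<odot> k))"
      unfolding m_def by (rule comp_plus_right[OF ie jk wr])
    also have "(w \<odot> r) \<odot> (i \<odot> e) = zero C a2 y"
      using comp_assoc[OF e(1) i wr] wri zero_comp[OF e(1) yob] by simp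
    also have "(w \<odot> r) \<odot> (j \<odot> k) = (((w \<odot> r) \<odot> j) \<odot> h3) \<odot> g"
      using comp_assoc[OF k j wr] k_def comp_assoc[OF g h3(1) wrj] by simp
    also have "zero C a2 y \<boxplus> ((((w \<odot> r) \<odot> j) \<odot> h3) \<odot> g) = (((w \<odot> r) \<odot> j) \<odot> h3) \<odot> g"
      by (rule plus_zero(2)[OF comp_arrow[OF g wrjh]])
    finally have "(((w \<odot> r) \<odot> j) \<odot> h3) \<odot> g = zero C a2 y" using wrm by simp
    then have "((w \<odot> r) \<odot> j) \<odot> h3 = zero C a3 y" by (rule epi_zero[OF short_exact_epi[OF F] g wrjh])
    then obtain t where t: "t \<in> arrows C n3 y" "t \<odot> p3 = (w \<odot> r) \<odot> j"
      by (rule short_exact_factor[OF H3 wrj])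
    have "(t \<odot> v) \<odot> r = ((w \<odot> r) \<odot> j) \<odot> \<rho>"
      using comp_assoc[OF r v(1) t(1)] v(2) comp_assoc[OF \<rho> p3 t(1)] t(2) by simp
    also have "\<dots> = zero C s y \<boxplus> (((w \<odot> r) \<odot> j) \<odot> \<rho>)"
      by (rule plus_zero(2)[OF comp_arrow[OF \<rho> wrj], symmetric])
    also have "zero C s y = (w \<odot> r) \<odot> (i \<odot> \<pi>)"
      using comp_assoc[OF \<pi> i wr] wri zero_comp[OF \<pi> yob] by simp
    also have "((w \<odot> r) \<odot> j) \<odot> \<rho> = (w \<odot> r) \<odot> (j \<odot> \<rho>)" by (rule comp_assoc[OF \<rho> j wr])
    also have "((w \<odot> r) \<odot> (i \<odot> \<pi>)) \<boxplus> ((w \<odot> r) \<odot> (j \<odot> \<rho>)) = (w \<odot> r) \<odot> ((i \<odot> \<pi>) \<boxplus> (j \<odot> \<rho>))"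
      by (rule comp_plus_right[OF comp_arrow[OF \<pi> i] comp_arrow[OF \<rho> j] wr, symmetric])
    also have "\<dots> = w \<odot> r" using sum comp_ident_right[OF wr] by simp
    finally have "t \<odot> v = w"
      by (rule epiD[OF short_exact_epi[OF R] r comp_arrow[OF v(1) t(1)] w(1)])
    then show "\<exists>t\<in>arrows C n3 y. t \<odot> v = w" using t(1) by blast
  qed
  then show thesis by (rule that[OF R])
qed

end

section \<open>Relative injective dimension\<close>

text \<open>A coresolution cut into short exact sequences: \<open>N\<close> is the first cosyzygy,
  and the rest coresolves it. This turns statements about long sequences into inductions over short
  ones. The base case replaces an isomorphism onto the only term by membership, in view of closure
  under isomorphisms.\<close>

primrec inj_dim_at_most ::
    "('o, 'm, 'x) preadditive_data_scheme \<Rightarrow> 'o set \<Rightarrow> nat \<Rightarrow> 'o \<Rightarrow> bool" where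
  "inj_dim_at_most C X 0 M \<longleftrightarrow> M \<in> X"
| "inj_dim_at_most C X (Suc n) M \<longleftrightarrow>
     (\<exists>x\<in>X. \<exists>f g N. short_exact C M f x g N \<and> inj_dim_at_most C X n N)"

lemma subcategory_obj:
  assumes "subcategory C X" "a \<in> X"
  shows "a \<in> obj C"
proof -
  have "X \<subseteq> obj C" using assms(1) unfolding subcategory_def by (elim conjE)
  then show ?thesis using assms(2) by blast
qed

lemma subcategory_zero:
  assumes "subcategory C X"
  obtains z where "z \<in> X" "zero_object C z"
proof -
  have "\<exists>z\<in>X. zero_object C z" using assms unfolding subcategory_def by (elim conjE)
  then show thesis using that by blast
qed

lemma subcategory_direct_sum:
  assumes "subcategory C X" "a \<in> X" "b \<in> X" "is_direct_sum C s a b"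
  shows "s \<in> X"
proof -
  have "\<forall>a\<in>X. \<forall>b\<in>X. \<forall>s. is_direct_sum C s a b \<longrightarrow> s \<in> X"
    using assms(1) unfolding subcategory_def by (elim conjE)
  then show ?thesis using assms(2-4) by blast
qed

lemma subcategory_iso:
  assumes "subcategory C X" "a \<in> X" "iso_objects C a b"
  shows "b \<in> X"
proof -
  have "\<forall>a\<in>X. \<forall>b. iso_objects C a b \<longrightarrow> b \<in> X" using assms(1) unfolding subcategory_def by (elim conjE)
  then show ?thesis using assms(2,3) by blast
qed

section \<open>Coresolutions as iterated short exact sequences\<close>

lemma exact_sequence_singleton: "exact_sequence C [f]"
  by (simp add: exact_sequence_def)

lemma exact_sequence_Cons:
  "exact_sequence C (f # g # fs) \<longleftrightarrow> exact_at C f g \<and> exact_sequence C (g # fs)"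
proof
  assume ex: "exact_sequence C (f # g # fs)"
  have "exact_at C ((g # fs) ! i) ((g # fs) ! Suc i)" if "Suc i < length (g # fs)" for i
    using ex[unfolded exact_sequence_def, rule_format, of "Suc i"] that by simp
  moreover have "exact_at C f g" using ex[unfolded exact_sequence_def, rule_format, of 0] by simp
  ultimately show "exact_at C f g \<and> exact_sequence C (g # fs)" by (simp add: exact_sequence_def)
next
  assume ex: "exact_at C f g \<and> exact_sequence C (g # fs)"
  have "exact_at C ((f # g # fs) ! i) ((f # g # fs) ! Suc i)"
    if "Suc i < length (f # g # fs)" for i
  proof (cases i)
    case 0
    then show ?thesis using ex by simp
  next
    case (Suc k)
    then show ?thesis using conjunct2[OF ex, unfolded exact_sequence_def, rule_format, of k] that
      by simp
  qed
  then show "exact_sequence C (f # g # fs)" by (simp add: exact_sequence_def)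
qed

context abelian_category
begin

text \<open>The image is computed from the cokernel alone, and precomposing with an epi does not
  change the cokernel.\<close>

lemma exact_at_precomp_epi:
  assumes e: "e \<in> arrows C a b" "is_epi C e" and f: "f \<in> arrows C b d"
  shows "exact_at C (f \<odot> e) g \<longleftrightarrow> exact_at C f g"
  using cokernel_precomp_epi[OF e f] arrowsD[OF f] arrowsD[OF comp_arrow[OF e(1) f]]
  by (simp add: exact_at_def is_image_def)

text \<open>With \<open>c\<close> the cokernel of the first arrow \<open>d\<close>, the second arrow
  \<open>e\<close> is a mono \<open>e'\<close> after \<open>c\<close>. Replacing \<open>e\<close> by
  \<open>e'\<close> keeps the codomains and the exactness further on, so \<open>e'\<close> starts a
  coresolution of the cokernel \<open>N\<close> that is shorter by one term.\<close>

lemma inj_dim_at_most_if_coresolution: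
  assumes X: "subcategory C X"
  shows "has_coresolution C X M n \<Longrightarrow> inj_dim_at_most C X n M"
proof (induction n arbitrary: M)
  case 0
  then obtain z d where z: "zero_object C z" and "dom C d = M" and dX: "cod C d \<in> X"
    and ex: "exact_sequence C [zero C z M, d, zero C (cod C d) z]"
    by (auto simp: has_coresolution_def length_Suc_conv)
  then have 1: "exact_at C (zero C z M) d" and 2: "exact_at C d (zero C (cod C d) z)"
    by (simp_all add: exact_sequence_Cons)
  have d: "d \<in> arrows C M (cod C d)"
    using 1 \<open>dom C d = M\<close> by (simp add: exact_at_def arrows_def)
  have "iso_objects C M (cod C d)"
    using mono_epi_iso[OF d] exact_at_from_zero_iff[OF z d] exact_at_to_zero_iff[OF z d] 1 2 by simp
  then have "iso_objects C (cod C d) M" unfolding iso_objects_def by blast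
  then show ?case using subcategory_iso[OF X dX] by simp
next
  case (Suc n)
  then obtain z ds where z: "zero_object C z" and len: "length ds = Suc (Suc n)"
    and domM: "dom C (hd ds) = M" and dsX: "\<forall>d\<in>set ds. cod C d \<in> X"
    and ex0: "exact_sequence C (zero C z M # ds @ [zero C (cod C (last ds)) z])"
    unfolding has_coresolution_def by blast
  obtain d e es where ds: "ds = d # e # es" and les: "length es = n"
    using len by (auto simp: length_Suc_conv)
  define x y where "x = cod C d" and "y = cod C e"
  define w where "w = zero C (cod C (last (e # es))) z"
  have 1: "exact_at C (zero C z M) d" and 2: "exact_at C d e"
    and 3: "exact_sequence C (e # es @ [w])"
    using ex0 by (simp_all add: ds exact_sequence_Cons w_def)
  have d: "d \<in> arrows C M x" and e: "e \<in> arrows C x y"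
    using 2 domM by (simp_all add: exact_at_def arrows_def ds x_def y_def)
  obtain m c where c: "is_cokernel C c d" and mc: "is_kernel C m c" and me: "is_kernel C m e"
    using 2 by (auto simp: exact_at_def is_image_def)
  define N where "N = cod C c"
  have ca: "c \<in> arrows C x N" using cokernel_arrows[OF c d] N_def by simp
  obtain e' where e': "e' \<in> arrows C N y" "is_mono C e'" "e' \<odot> c = e"
    using epi_mono_factorisation[OF epi_cokernel_kernel[OF cokernel_epi[OF c] mc] me ca e] .
  have ce': "cod C e' = y" "dom C e' = N" using arrowsD[OF e'(1)] by simp_all
  \<comment> \<open>The arrow after \<open>e\<close> is the final zero arrow if \<open>es\<close> is
    empty and the head of \<open>es\<close> otherwise; naming it \<open>l\<close> treats both cases
    at once.\<close>
  obtain l ls where l: "es @ [w] = l # ls" by (cases "es @ [w]") auto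
  have "exact_sequence C (e' # l # ls)"
    using 3 exact_at_precomp_epi[OF ca cokernel_epi[OF c] e'(1), of l] e'(3)
    unfolding l by (simp add: exact_sequence_Cons)
  moreover have "cod C (last (e' # es)) = cod C (last (e # es))" using ce' y_def by simp
  ultimately have "exact_sequence C (zero C z N # (e' # es) @ [zero C (cod C (last (e' # es))) z])"
    using exact_at_from_zero_iff[OF z e'(1)] e'(2) l by (simp add: exact_sequence_Cons w_def)
  moreover have "\<forall>d\<in>set (e' # es). cod C d \<in> X" using dsX ds ce' y_def by simp
  ultimately have "has_coresolution C X N n"
    unfolding has_coresolution_def using z les ce'
    by (intro exI[of _ z] exI[of _ "e' # es"]) simp
  then have "inj_dim_at_most C X n N" by (rule Suc.IH)
  moreover have "short_exact C M d x c N"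
    using d ca c 1 exact_at_from_zero_iff[OF z d] by (simp add: short_exact_iff)
  moreover have "x \<in> X" using dsX ds x_def by simp
  ultimately show ?case by auto
qed

text \<open>The converse splices. If \<open>e\<close> embeds \<open>N\<close> into the first term of
  its coresolution, then \<open>f\<close> is followed by \<open>e \<odot> g\<close>: its kernel is
  that of \<open>g\<close> as \<open>e\<close> is mono, and its image is that of \<open>e\<close> as
  \<open>g\<close> is epi.\<close>

lemma coresolution_if_inj_dim_at_most:
  assumes X: "subcategory C X"
  shows "inj_dim_at_most C X n M \<Longrightarrow> has_coresolution C X M n"
proof (induction n arbitrary: M)
  case 0
  then have M: "M \<in> X" "M \<in> obj C" using subcategory_obj[OF X] by simp_all
  obtain z where z: "zero_object C z" using zero_object_exists by blast
  note i = ident_arrow[OF M(2)]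
  have "exact_sequence C [zero C z M, ident C M, zero C M z]"
    using exact_at_from_zero_iff[OF z i] exact_at_to_zero_iff[OF z i] mono_ident[OF M(2)]
      epi_ident[OF M(2)] by (simp add: exact_sequence_Cons exact_sequence_singleton)
  then show ?case
    unfolding has_coresolution_def using z M arrowsD[OF i]
    by (intro exI[of _ z] exI[of _ "[ident C M]"]) simp
next
  case (Suc n)
  then obtain x f g N where x: "x \<in> X" and F: "short_exact C M f x g N"
    and N: "inj_dim_at_most C X n N" by auto
  obtain z ds where z: "zero_object C z" and len: "length ds = Suc n"
    and domN: "dom C (hd ds) = N" and dsX: "\<forall>d\<in>set ds. cod C d \<in> X"
    and ex: "exact_sequence C (zero C z N # ds @ [zero C (cod C (last ds)) z])"
    using Suc.IH[OF N] unfolding has_coresolution_def by blast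
  obtain e es where ds: "ds = e # es" and les: "length es = n" using len by (auto simp: length_Suc_conv)
  define w where "w = zero C (cod C (last (e # es))) z"
  define y where "y = cod C e"
  have 1: "exact_at C (zero C z N) e" and 2: "exact_sequence C (e # es @ [w])"
    using ex by (simp_all add: ds exact_sequence_Cons w_def)
  have e: "e \<in> arrows C N y" using 1 domN by (simp add: exact_at_def arrows_def ds y_def)
  have e_mono: "is_mono C e" using 1 exact_at_from_zero_iff[OF z e] by simp
  have f: "f \<in> arrows C M x" "is_mono C f" and g: "g \<in> arrows C x N" and gf: "is_cokernel C g f"
    using F by (simp_all add: short_exact_iff)
  have eg: "e \<odot> g \<in> arrows C x y" using g e by (rule comp_arrow)
  obtain l ls where l: "es @ [w] = l # ls" by (cases "es @ [w]") auto
  have "exact_sequence C ((e \<odot> g) # l # ls)"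
    using 2 exact_at_precomp_epi[OF g cokernel_epi[OF gf] e, of l]
    unfolding l by (simp add: exact_sequence_Cons)
  moreover have "exact_at C f (e \<odot> g)"
    using kernel_postcomp_mono[OF e e_mono g short_exact_kernel[OF F]] gf short_exact_kernel[OF F]
      arrowsD[OF f(1)] arrowsD[OF eg] unfolding exact_at_def is_image_def by auto
  moreover have "cod C (last ((e \<odot> g) # es)) = cod C (last (e # es))"
    using arrowsD[OF eg] y_def by simp
  ultimately have
    "exact_sequence C (zero C z M # (f # (e \<odot> g) # es) @ [zero C (cod C (last (f # (e \<odot> g) # es))) z])"
    using exact_at_from_zero_iff[OF z f(1)] f(2) l by (simp add: exact_sequence_Cons w_def)
  moreover have "\<forall>d\<in>set (f # (e \<odot> g) # es). cod C d \<in> X"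
    using dsX ds x arrowsD[OF f(1)] arrowsD[OF eg] y_def by simp
  ultimately show ?case
    unfolding has_coresolution_def using z les arrowsD[OF f(1)]
    by (intro exI[of _ z] exI[of _ "f # (e \<odot> g) # es"]) simp
qed

lemma has_coresolution_iff:
  assumes "subcategory C X"
  shows "has_coresolution C X M n \<longleftrightarrow> inj_dim_at_most C X n M"
  using inj_dim_at_most_if_coresolution[OF assms] coresolution_if_inj_dim_at_most[OF assms] by blast

text \<open>The predicate prescribes the length exactly, so monotonicity needs an argument: a zero
  term, available in \<open>X\<close>, is appended at the far end.\<close>

lemma inj_dim_at_most_Suc:
  assumes X: "subcategory C X"
  shows "inj_dim_at_most C X n M \<Longrightarrow> inj_dim_at_most C X (Suc n) M"
proof (induction n arbitrary: M)
  case 0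
  obtain z where z: "z \<in> X" "zero_object C z" using subcategory_zero[OF X] .
  have M: "M \<in> X" "M \<in> obj C" using 0 subcategory_obj[OF X] by simp_all
  show ?case using short_exact_to_zero[OF z(2) M(2)] z(1) M(1) by auto
next
  case (Suc n)
  then obtain x f g N where "x \<in> X" "short_exact C M f x g N" "inj_dim_at_most C X n N" by auto
  then have "\<exists>x\<in>X. \<exists>f g N. short_exact C M f x g N \<and> inj_dim_at_most C X (Suc n) N"
    using Suc.IH by blast
  then show ?case by (subst inj_dim_at_most.simps(2))
qed

lemma inj_dim_at_most_mono:
  assumes "subcategory C X" "m \<le> n" "inj_dim_at_most C X m M"
  shows "inj_dim_at_most C X n M"
  using assms(2,3) by (induction rule: dec_induct) (blast intro: inj_dim_at_most_Suc[OF assms(1)])+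

text \<open>A finite bound excludes the empty set of lengths, whose infimum is infinite. Otherwise
  the infimum is attained, and the coresolution of minimal length is padded up to
  \<open>n\<close>.\<close>

lemma inj_dim_le_iff:
  assumes X: "subcategory C X"
  shows "inj_dim C X M \<le> enat n \<longleftrightarrow> inj_dim_at_most C X n M"
proof
  let ?S = "enat ` {n. has_coresolution C X M n}"
  assume le: "inj_dim C X M \<le> enat n"
  have "?S \<noteq> {}"
  proof
    assume empty: "?S = {}"
    show False using le unfolding inj_dim_def empty by (simp add: Inf_enat_def)
  qed
  then obtain s where s: "s \<in> ?S" by blast
  then have "inj_dim C X M \<in> ?S"
    unfolding inj_dim_def Inf_enat_def using LeastI[of "\<lambda>x. x \<in> ?S", OF s] by auto
  then obtain k where "inj_dim C X M = enat k" "has_coresolution C X M k" by auto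
  then show "inj_dim_at_most C X n M"
    using le has_coresolution_iff[OF X] inj_dim_at_most_mono[OF X] by auto
next
  assume "inj_dim_at_most C X n M"
  then show "inj_dim C X M \<le> enat n"
    unfolding inj_dim_def using has_coresolution_iff[OF X] by (intro Inf_lower) auto
qed

end

section \<open>Bounds along short exact sequences over a coresolving subcategory\<close>

locale coresolving_subcategory = abelian_category C for C (structure) +
  fixes X
  assumes inj: "enough_injectives C" and sub: "subcategory C X" and cores: "coresolving C X"
begin

lemma injective_mem: "injective_object C e \<Longrightarrow> e \<in> X"
  using cores unfolding coresolving_def by blast

lemma extension_mem: "\<lbrakk>short_exact C a f b g c; a \<in> X; c \<in> X\<rbrakk> \<Longrightarrow> b \<in> X"
  using cores unfolding coresolving_def by blast

lemma cokernel_mem: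
  assumes F: "short_exact C a f b g c" and "a \<in> X" "b \<in> X"
  shows "c \<in> X"
proof -
  have "is_mono C f" "is_cokernel C g f" "dom C f = a" "cod C f = b" "cod C g = c"
    using F by (auto simp: short_exact_iff arrows_def)
  then show ?thesis using cores assms(2,3) unfolding coresolving_def by blast
qed

text \<open>Embed the first term \<open>x\<close> into an injective \<open>e\<close>. Then
  \<open>e/a\<close> is an extension of \<open>e/x\<close> by \<open>N = x/a\<close>, and
  \<open>e/x\<close> lies in \<open>X\<close> as a cokernel between members. The extension rule at
  level \<open>n\<close> is an assumption here because this lemma is applied inside the induction
  that proves it.\<close>

lemma injective_first_step:
  assumes ext: "\<And>a f b g c. \<lbrakk>short_exact C a f b g c; inj_dim_at_most C X n a; inj_dim_at_most C X n c\<rbrakk>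
      \<Longrightarrow> inj_dim_at_most C X n b"
    and "inj_dim_at_most C X (Suc n) a"
  obtains h e p c where "injective_object C e" "short_exact C a h e p c" "inj_dim_at_most C X n c"
proof -
  obtain x f g N where x: "x \<in> X" and F: "short_exact C a f x g N" and N: "inj_dim_at_most C X n N"
    using assms(2) by auto
  have "x \<in> obj C" using subcategory_obj[OF sub x] .
  then obtain e m where e: "injective_object C e" and m: "m \<in> arrows C x e" "is_mono C m"
    using inj unfolding enough_injectives_def by blast
  obtain p q where P: "short_exact C x m e p q" using mono_short_exact[OF m] .
  have "inj_dim_at_most C X 0 q" using cokernel_mem[OF P x injective_mem[OF e]] by simp
  then have q: "inj_dim_at_most C X n q" using inj_dim_at_most_mono[OF sub] by blast
  obtain r d u v where R: "short_exact C a (m \<odot> f) e r d" and D: "short_exact C N u d v q"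
    using short_exact_mono_comp[OF inj F P] .
  show thesis using that[OF e R ext[OF D N q]] .
qed

lemma inj_dim_at_most_extension:
  "\<lbrakk>short_exact C a f b g c; inj_dim_at_most C X n a; inj_dim_at_most C X n c\<rbrakk>
    \<Longrightarrow> inj_dim_at_most C X n b"
proof (induction n arbitrary: a f b g c)
  case 0
  then show ?case using extension_mem by simp
next
  case (Suc n)
  obtain h1 e p1 n1 where e: "injective_object C e" and H1: "short_exact C a h1 e p1 n1"
    and n1: "inj_dim_at_most C X n n1"
    using injective_first_step[OF Suc.IH Suc.prems(2)] .
  \<comment> \<open>No injective is required on this side: only \<open>h1\<close> has to be extended
    along \<open>f\<close>, so any first term in \<open>X\<close> will do for
    \<open>c\<close>.\<close>
  obtain x h3 p3 n3 where x: "x \<in> X" and H3: "short_exact C c h3 x p3 n3"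
    and n3: "inj_dim_at_most C X n n3"
    using Suc.prems(3) by auto
  have eX: "e \<in> X" using injective_mem[OF e] .
  obtain s where S: "is_direct_sum C s e x"
    using direct_sum_exists[OF subcategory_obj[OF sub eX] subcategory_obj[OF sub x]] by blast
  have sX: "s \<in> X" using subcategory_direct_sum[OF sub eX x S] .
  obtain m r q u v where "short_exact C b m s r q" and Q: "short_exact C n1 u q v n3"
    using horseshoe[OF inj e Suc.prems(1) H1 H3 S] .
  then show ?case using sX Suc.IH[OF Q n1 n3] by auto
qed

text \<open>The case of a left term in \<open>X\<close>. If \<open>p\<close> embeds into
  \<open>y\<close> in \<open>X\<close>, then \<open>c = p/x\<close> embeds into \<open>y/x\<close>,
  which lies in \<open>X\<close>, and the cokernel is still \<open>N = y/p\<close>.\<close>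

lemma inj_dim_at_most_cokernel_mem:
  assumes F: "short_exact C x f p g c" and x: "x \<in> X" and p: "inj_dim_at_most C X n p"
  shows "inj_dim_at_most C X n c"
proof (cases n)
  case 0
  then show ?thesis using cokernel_mem[OF F x] p by simp
next
  case (Suc k)
  then obtain y h q N where y: "y \<in> X" and H: "short_exact C p h y q N"
    and N: "inj_dim_at_most C X k N" using p by auto
  obtain r d u v where "short_exact C x (h \<odot> f) y r d" and "short_exact C c u d v N"
    using short_exact_mono_comp[OF inj F H] .
  then show ?thesis using Suc N cokernel_mem[OF _ x y] by auto
qed

text \<open>The embedding of \<open>b\<close> into \<open>x\<close> also embeds \<open>a\<close>,
  and \<open>x/a\<close> is an extension of \<open>N = x/b\<close> by
  \<open>c = b/a\<close>.\<close>

lemma inj_dim_at_most_kernel: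
  assumes F: "short_exact C a f b g c" and b: "inj_dim_at_most C X (Suc n) b"
    and c: "inj_dim_at_most C X n c"
  shows "inj_dim_at_most C X (Suc n) a"
proof -
  obtain x h q N where x: "x \<in> X" and H: "short_exact C b h x q N"
    and N: "inj_dim_at_most C X n N" using b by auto
  obtain r d u v where "short_exact C a (h \<odot> f) x r d" and D: "short_exact C c u d v N"
    using short_exact_mono_comp[OF inj F H] .
  then show ?thesis using x inj_dim_at_most_extension[OF D c N] by auto
qed

text \<open>
  Applying the horseshoe lemma to \<open>a \<rightarrow> e\<close> and the identity of \<open>c\<close> embeds \<open>b\<close> into
  \<open>e \<oplus> c\<close> with cokernel that of \<open>a \<rightarrow> e\<close>; this replaces a pushout.
\<close>

lemma inj_dim_at_most_cokernel:
  assumes F: "short_exact C a f b g c" and a: "inj_dim_at_most C X (Suc n) a"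
    and b: "inj_dim_at_most C X n b"
  shows "inj_dim_at_most C X n c"
proof -
  obtain h e p n1 where e: "injective_object C e" and H: "short_exact C a h e p n1"
    and n1: "inj_dim_at_most C X n n1"
    using injective_first_step[OF inj_dim_at_most_extension a] .
  obtain z where z: "z \<in> X" "zero_object C z" using subcategory_zero[OF sub] .
  have "inj_dim_at_most C X 0 z" using z(1) by simp
  then have zn: "inj_dim_at_most C X n z" using inj_dim_at_most_mono[OF sub] by blast
  have c: "c \<in> obj C" using F arrows_obj by (auto simp: short_exact_iff)
  have eX: "e \<in> X" using injective_mem[OF e] .
  obtain s where S: "is_direct_sum C s e c"
    using direct_sum_exists[OF subcategory_obj[OF sub eX] c] by blast
  obtain m r q u v where M: "short_exact C b m s r q" and Q: "short_exact C n1 u q v z"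
    using horseshoe[OF inj e F H short_exact_to_zero[OF z(2) c] S] .
  \<comment> \<open>Here \<open>q\<close> is an extension of the zero object by \<open>n1\<close>,
    and \<open>s\<close> is an extension of \<open>q\<close> by \<open>b\<close>; all of these have
    bound \<open>n\<close>.\<close>
  have s: "inj_dim_at_most C X n s"
    using inj_dim_at_most_extension[OF M b inj_dim_at_most_extension[OF Q n1 zn]] .
  \<comment> \<open>The split sequence from \<open>e\<close> over \<open>s\<close> to
    \<open>c\<close> has its left term in \<open>X\<close>, so the special case hands the bound for
    \<open>s\<close> on to the summand \<open>c\<close>.\<close>
  obtain i \<rho> where "short_exact C e i s \<rho> c"
    using S direct_sum_short_exact unfolding is_direct_sum_def by blast
  then show ?thesis using inj_dim_at_most_cokernel_mem eX s by blast
qed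

section \<open>From bounds to inequalities between dimensions\<close>

lemma inj_dim_extension:
  assumes F: "short_exact C a f b g c"
  shows "inj_dim C X b \<le> max (inj_dim C X a) (inj_dim C X c)"
proof (cases "max (inj_dim C X a) (inj_dim C X c)")
  case (enat n)
  then have "inj_dim C X a \<le> enat n" "inj_dim C X c \<le> enat n" by (metis max.cobounded1 max.cobounded2)+
  then show ?thesis using enat inj_dim_at_most_extension[OF F] by (simp add: inj_dim_le_iff[OF sub])
qed simp

lemma inj_dim_cokernel:
  assumes F: "short_exact C a f b g c"
  shows "inj_dim C X c \<le> max (inj_dim C X a - 1) (inj_dim C X b)"
proof (cases "max (inj_dim C X a - 1) (inj_dim C X b)")
  case (enat n)
  then have "inj_dim C X a - 1 \<le> enat n" "inj_dim C X b \<le> enat n"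
    by (metis max.cobounded1 max.cobounded2)+
  \<comment> \<open>Truncation does no harm: \<open>0 - 1 = 0\<close> still yields the bound
    \<open>Suc n\<close> for a dimension \<open>0\<close>.\<close>
  then have "inj_dim C X a \<le> enat (Suc n)" "inj_dim C X b \<le> enat n"
    by (cases "inj_dim C X a"; simp add: one_enat_def)+
  then show ?thesis using enat inj_dim_at_most_cokernel[OF F] by (simp add: inj_dim_le_iff[OF sub])
qed simp

lemma inj_dim_kernel:
  assumes F: "short_exact C a f b g c"
  shows "inj_dim C X a \<le> max (inj_dim C X b) (inj_dim C X c + 1)"
proof (cases "max (inj_dim C X b) (inj_dim C X c + 1)")
  case (enat n)
  then have b: "inj_dim C X b \<le> enat n" and c: "inj_dim C X c + 1 \<le> enat n"
    by (metis max.cobounded1 max.cobounded2)+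
  \<comment> \<open>The summand \<open>1\<close> forces \<open>n\<close> to be positive, which
    matches the successor in the rule for kernels.\<close>
  then obtain k where "n = Suc k" "inj_dim C X c \<le> enat k"
    by (cases "inj_dim C X c"; cases n) (auto simp: one_enat_def)
  then show ?thesis using enat b inj_dim_at_most_kernel[OF F] by (simp add: inj_dim_le_iff[OF sub])
qed simp

end

text \<open>The side condition decides which argument of \<open>max\<close> dominates, and another
  of the inequalities then gives the reverse estimate. For the first claim, \<open>a > c + 1\<close>
  together with the third inequality forces \<open>a \<le> b\<close>, while \<open>a \<le> c\<close>
  with \<open>c\<close> positive makes \<open>a - 1\<close> too small in the second, so
  \<open>c \<le> b\<close>. That \<open>a\<close> and \<open>c\<close> are both infinite is ruled
  out by \<open>\<infinity> = \<infinity> + 1\<close>.\<close>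

lemma enat_dimension_arithmetic:
  fixes a b c :: enat
  assumes "b \<le> max a c" "c \<le> max (a - 1) b" "a \<le> max b (c + 1)"
  shows "a \<noteq> c + 1 \<Longrightarrow> b = max a c"
    and "a \<noteq> b \<Longrightarrow> c = max (a - 1) b"
    and "b \<noteq> c \<Longrightarrow> a = max b (c + 1)"
  using assms by (cases a; cases b; cases c; auto simp: one_enat_def max_def split: if_splits)+

theorem theorem3p9:
  fixes A :: "('o, 'm) preadditive_data" and T :: "'o set"
  assumes "abelian_category A"
    and "enough_injectives A"
    and "subcategory A T"
    and "\<And>e. injective_object A e \<Longrightarrow> e \<in> T"
  shows "coresolving A T \<longleftrightarrow>
    (\<forall>A1 f A2 g A3. short_exact A A1 f A2 g A3 \<longrightarrow>
      (inj_dim A T A2 \<le> max (inj_dim A T A1) (inj_dim A T A3) \<and>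
        (inj_dim A T A1 \<noteq> inj_dim A T A3 + 1 \<longrightarrow>
          inj_dim A T A2 = max (inj_dim A T A1) (inj_dim A T A3))) \<and>
      (inj_dim A T A3 \<le> max (inj_dim A T A1 - 1) (inj_dim A T A2) \<and>
        (inj_dim A T A1 \<noteq> inj_dim A T A2 \<longrightarrow>
          inj_dim A T A3 = max (inj_dim A T A1 - 1) (inj_dim A T A2))) \<and>
      (inj_dim A T A1 \<le> max (inj_dim A T A2) (inj_dim A T A3 + 1) \<and>
        (inj_dim A T A2 \<noteq> inj_dim A T A3 \<longrightarrow>
          inj_dim A T A1 = max (inj_dim A T A2) (inj_dim A T A3 + 1))))"
    (is "_ \<longleftrightarrow> ?dims")
proof
  interpret abelian_category A by (fact assms(1))
  show ?dims if cores: "coresolving A T"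
  proof (intro allI impI)
    interpret coresolving_subcategory A T
      by unfold_locales (fact assms(2) assms(3) cores)+
    fix A1 f A2 g A3 assume F: "short_exact A A1 f A2 g A3"
    note bounds = inj_dim_extension[OF F] inj_dim_cokernel[OF F] inj_dim_kernel[OF F]
    show "(inj_dim A T A2 \<le> max (inj_dim A T A1) (inj_dim A T A3) \<and>
        (inj_dim A T A1 \<noteq> inj_dim A T A3 + 1 \<longrightarrow>
          inj_dim A T A2 = max (inj_dim A T A1) (inj_dim A T A3))) \<and>
      (inj_dim A T A3 \<le> max (inj_dim A T A1 - 1) (inj_dim A T A2) \<and>
        (inj_dim A T A1 \<noteq> inj_dim A T A2 \<longrightarrow>
          inj_dim A T A3 = max (inj_dim A T A1 - 1) (inj_dim A T A2))) \<and>
      (inj_dim A T A1 \<le> max (inj_dim A T A2) (inj_dim A T A3 + 1) \<and>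
        (inj_dim A T A2 \<noteq> inj_dim A T A3 \<longrightarrow>
          inj_dim A T A1 = max (inj_dim A T A2) (inj_dim A T A3 + 1)))"
      by (intro conjI impI bounds enat_dimension_arithmetic[OF bounds])
  qed
  show "coresolving A T" if dims: ?dims
  proof -
    \<comment> \<open>Membership is read off from the dimension, so the closure properties are the
      cases of the inequalities in which the right-hand side is \<open>0\<close>.\<close>
    have zero_iff: "inj_dim A T M = 0 \<longleftrightarrow> M \<in> T" for M
      using inj_dim_le_iff[OF assms(3), of M 0] by (simp add: zero_enat_def[symmetric])
    have "b \<in> T" if F: "short_exact A a f b g c" and "a \<in> T" "c \<in> T" for a f b g c
    proof -
      have "inj_dim A T b \<le> max (inj_dim A T a) (inj_dim A T c)" using dims F by blast
      then show ?thesis using that(2,3) by (simp flip: zero_iff)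
    qed
    moreover have "cod A c \<in> T"
      if m: "is_mono A m" "dom A m \<in> T" "cod A m \<in> T" and c: "is_cokernel A c m" for m c
    proof -
      have ma: "m \<in> arrows A (dom A m) (cod A m)" using m(1) arrowsI by (auto simp: is_mono_def)
      have "short_exact A (dom A m) m (cod A m) c (cod A c)"
        using ma cokernel_arrows[OF c ma] m(1) c by (simp add: short_exact_iff)
      \<comment> \<open>Both dimensions on the right are \<open>0\<close>, and so is the maximum,
        because \<open>0 - 1\<close> is \<open>0\<close> in \<open>enat\<close>.\<close>
      then have "inj_dim A T (cod A c) \<le> max (inj_dim A T (dom A m) - 1) (inj_dim A T (cod A m))"
        using dims by blast
      then show ?thesis using m(2,3) by (simp flip: zero_iff)
    qed
    ultimately show ?thesis using assms(4) unfolding coresolving_def by blast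
  qed
qed

end
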